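(* Let $1\le r\le m\le n$ and let $U$ be a generic $m\times n$ data matrix. Let $P_1$ be an $r\times r$ matrix, $L_1$ an $(m-r)\times r$ matrix, $R_1$ an $r\times(n-r)$ matrix and $\Lambda$ an $(n-r)\times(m-r)$ matrix, all of whose entries are independent unknowns, and set $$L=\begin{pmatrix}L_1 & -I_{m-r}\end{pmatrix},\qquad P=\begin{pmatrix}P_1 & P_1R_1\\ L_1P_1 & L_1P_1R_1\end{pmatrix},\qquad R=\begin{pmatrix}R_1\\ -I_{n-r}\end{pmatrix}.$$ Then the polynomial system $$P\star(R\cdot\Lambda\cdot L)^T+u_{++}\cdot P=U$$ consists of $mn$ equations in $mn$ unknowns. It has finitely many complex solutions $(P_1,L_1,R_1,\Lambda)$, and the corresponding $m\times n$ matrices $P$ are precisely the critical points of the likelihood function $\ell_U$ on the determinantal variety $\mathcal{V}_r$.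
   Context: Here $A\star B$ denotes the Hadamard (entrywise) product of two matrices of the same format, $I_k$ is the $k\times k$ identity matrix, and $u_{++}=\sum_{i,j}u_{ij}$ for $U=(u_{ij})$. "Generic" means that $U$ lies outside some proper Zariski closed subset of the space of $m\times n$ matrices. $\mathcal{V}_r=\{P\in\mathbb{C}^{m\times n}:\operatorname{rank}(P)\le r\}$. The likelihood function is $$\ell_U=\frac{\prod_{i,j}p_{ij}^{u_{ij}}}{\bigl(\sum_{i,j}p_{ij}\bigr)^{u_{++}}}.$$ Critical points of $\ell_U$ on $\mathcal{V}_r$ are normalized to have entry sum $1$: they are the complex matrices $P$ of rank exactly $r$ with $p_{++}=\sum_{i,j}p_{ij}=1$ and all $p_{ij}\ne0$ such that the matrix with entries $u_{ij}/p_{ij}-u_{++}$ lies in $T_P^\perp$, where $T_P\subset\mathbb{C}^{m\times n}$ is the tangent space of $\mathcal{V}_r$ at $P$ and $\perp$ is taken with respect to the standard bilinear form $\sum_{i,j} a_{ij}b_{ij}$. *)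

theory Defs
  imports Complex_Main "Jordan_Normal_Form.DL_Rank"
begin

inductive_set poly_funs :: "nat \<Rightarrow> nat \<Rightarrow> (complex mat \<Rightarrow> complex) set"
  for m n :: nat where
  const: "(\<lambda>A. c) \<in> poly_funs m n"
| entry: "i < m \<Longrightarrow> j < n \<Longrightarrow> (\<lambda>A. A $$ (i, j)) \<in> poly_funs m n"
| add: "f \<in> poly_funs m n \<Longrightarrow> g \<in> poly_funs m n \<Longrightarrow> (\<lambda>A. f A + g A) \<in> poly_funs m n"
| mult: "f \<in> poly_funs m n \<Longrightarrow> g \<in> poly_funs m n \<Longrightarrow> (\<lambda>A. f A * g A) \<in> poly_funs m n"

definition zariski_closed :: "nat \<Rightarrow> nat \<Rightarrow> complex mat set \<Rightarrow> bool" where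
  "zariski_closed m n Z \<longleftrightarrow>
     (\<exists>F \<subseteq> poly_funs m n. Z = {A \<in> carrier_mat m n. \<forall>f\<in>F. f A = 0})"

definition for_generic :: "nat \<Rightarrow> nat \<Rightarrow> (complex mat \<Rightarrow> bool) \<Rightarrow> bool" where
  "for_generic m n Q \<longleftrightarrow>
     (\<exists>Z. zariski_closed m n Z \<and> Z \<subset> carrier_mat m n \<and> (\<forall>U \<in> carrier_mat m n - Z. Q U))"

definition determinantal_variety :: "nat \<Rightarrow> nat \<Rightarrow> nat \<Rightarrow> complex mat set" where
  "determinantal_variety m n r = {P \<in> carrier_mat m n. vec_space.rank m P \<le> r}"

text \<open>The Zariski tangent space of \<open>V\<close> at \<open>P\<close>: the directions along which every polynomial
  vanishing on \<open>V\<close> has directional derivative zero at \<open>P\<close>.\<close>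

definition tangent_space :: "nat \<Rightarrow> nat \<Rightarrow> complex mat set \<Rightarrow> complex mat \<Rightarrow> complex mat set" where
  "tangent_space m n V P =
     {X \<in> carrier_mat m n. \<forall>f \<in> poly_funs m n. (\<forall>A\<in>V. f A = 0) \<longrightarrow>
        ((\<lambda>t. f (P + t \<cdot>\<^sub>m X)) has_field_derivative 0) (at 0)}"

text \<open>The form below is bilinear, without complex conjugation.\<close>

definition mat_form :: "nat \<Rightarrow> nat \<Rightarrow> complex mat \<Rightarrow> complex mat \<Rightarrow> complex" where
  "mat_form m n A B = (\<Sum>i<m. \<Sum>j<n. A $$ (i, j) * B $$ (i, j))"

definition mat_perp :: "nat \<Rightarrow> nat \<Rightarrow> complex mat set \<Rightarrow> complex mat set" where
  "mat_perp m n T = {A \<in> carrier_mat m n. \<forall>B\<in>T. mat_form m n A B = 0}"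

text \<open>Critical points, normalized to entry sum \<open>1\<close>, of the likelihood function
  \<open>(\<Prod>i j. p i j ^ u i j) / (\<Sum>i j. p i j) ^ (\<Sum>i j. u i j)\<close> on the matrices of rank at most \<open>r\<close>.
  At entry sum \<open>1\<close> the matrix required to be normal to the tangent space is the gradient of
  the logarithm of that function; this makes sense for every complex data matrix \<open>U\<close>.\<close>

definition critical_points :: "nat \<Rightarrow> nat \<Rightarrow> nat \<Rightarrow> complex mat \<Rightarrow> complex mat set" where
  "critical_points m n r U =
     {P \<in> carrier_mat m n.
        vec_space.rank m P = r \<and> sum_mat P = 1 \<and>
        (\<forall>i<m. \<forall>j<n. P $$ (i, j) \<noteq> 0) \<and>
        mat m n (\<lambda>(i, j). U $$ (i, j) / P $$ (i, j) - sum_mat U)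
          \<in> mat_perp m n (tangent_space m n (determinantal_variety m n r) P)}"

definition hadamard :: "'a :: times mat \<Rightarrow> 'a mat \<Rightarrow> 'a mat" (infixl "\<star>" 70) where
  "A \<star> B = mat (dim_row A) (dim_col A) (\<lambda>ij. A $$ ij * B $$ ij)"

definition append_cols :: "'a :: zero mat \<Rightarrow> 'a mat \<Rightarrow> 'a mat" (infixr "@\<^sub>c" 65) where
  "A @\<^sub>c B = four_block_mat A B (0\<^sub>m 0 (dim_col A)) (0\<^sub>m 0 (dim_col B))"

definition block_P :: "complex mat \<Rightarrow> complex mat \<Rightarrow> complex mat \<Rightarrow> complex mat" where
  "block_P P1 L1 R1 = four_block_mat P1 (P1 * R1) (L1 * P1) (L1 * P1 * R1)"

definition block_L :: "complex mat \<Rightarrow> complex mat" where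
  "block_L L1 = L1 @\<^sub>c - 1\<^sub>m (dim_row L1)"

definition block_R :: "complex mat \<Rightarrow> complex mat" where
  "block_R R1 = R1 @\<^sub>r - 1\<^sub>m (dim_col R1)"

definition system_lhs ::
    "complex mat \<Rightarrow> complex mat \<times> complex mat \<times> complex mat \<times> complex mat \<Rightarrow> complex mat" where
  "system_lhs U = (\<lambda>(P1, L1, R1, \<Lambda>).
     block_P P1 L1 R1 \<star> (block_R R1 * \<Lambda> * block_L L1)\<^sup>T + sum_mat U \<cdot>\<^sub>m block_P P1 L1 R1)"

definition unknowns ::
    "nat \<Rightarrow> nat \<Rightarrow> nat \<Rightarrow> (complex mat \<times> complex mat \<times> complex mat \<times> complex mat) set" where
  "unknowns m n r =
     carrier_mat r r \<times> carrier_mat (m - r) r \<times> carrier_mat r (n - r) \<times> carrier_mat (n - r) (m - r)"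

text \<open>The positions of the scalar unknowns: the disjoint union of the entry positions of
  the four blocks in \<^const>\<open>unknowns\<close>.\<close>

abbreviation mat_positions :: "nat \<Rightarrow> nat \<Rightarrow> (nat \<times> nat) set" where
  "mat_positions a b \<equiv> {0..<a} \<times> {0..<b}"

definition unknown_positions ::
    "nat \<Rightarrow> nat \<Rightarrow> nat \<Rightarrow> (nat \<times> nat + nat \<times> nat + nat \<times> nat + nat \<times> nat) set" where
  "unknown_positions m n r =
     mat_positions r r <+> mat_positions (m - r) r <+> mat_positions r (n - r)
       <+> mat_positions (n - r) (m - r)"

definition solutions ::
    "nat \<Rightarrow> nat \<Rightarrow> nat \<Rightarrow> complex mat \<Rightarrow> (complex mat \<times> complex mat \<times> complex mat \<times> complex mat) set" where
  "solutions m n r U = {x \<in> unknowns m n r. system_lhs U x = U}"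

end

theory Submission
  imports Defs
begin

text \<open>
  For generic \<open>U\<close> all entries and their sum \<open>s\<close> are nonzero. Replacing \<open>P\<^sub>1\<close> by \<open>s P\<^sub>1\<close> and
  \<open>\<Lambda>\<close> by \<open>\<Lambda> / s\<close> turns the system into \<open>P \<star> ((R \<Lambda> L)\<^sup>T + J) = U\<close>, where
  \<open>J\<close> is the all-ones matrix. Now the left-hand side no longer depends on \<open>U\<close>. The \<open>m n\<close>
  unknowns fill one matrix \<open>X\<close> with blocks \<open>P\<^sub>1, R\<^sub>1, L\<^sub>1, \<Lambda>\<^sup>T\<close>, so the system
  says \<open>\<Psi>(X) = U\<close> for a polynomial self-map \<open>\<Psi>\<close> of the space of \<open>m \<times> n\<close> matrices
  (\<open>rescaled_system\<close>).

  The other genericity statements follow from one fact about polynomial self-maps \<open>\<Phi>\<close> of an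
  \<open>N\<close>-dimensional space: for any polynomial \<open>h\<close>, the \<open>N + 1\<close> polynomials \<open>h\<close> and
  \<open>\<Phi>\<^sub>1, \<dots>, \<Phi>\<^sub>N\<close> in \<open>N\<close> variables are algebraically dependent
  (\<open>algebraic_dependence\<close>). With \<open>h\<close> a coordinate this makes generic fibres finite
  (\<open>generic_finite_fibre\<close>), which gives finitely many solutions. With \<open>h\<close> nonzero, after
  dividing the relation by a power of \<open>h\<close>, it shows that \<open>\<Phi>\<close> maps the hypersurface
  \<open>h = 0\<close> into a hypersurface (\<open>generic_avoids_image_of_hypersurface\<close>): a generic \<open>U\<close>
  has no preimage with \<open>h = 0\<close>.

  The geometry of the determinantal variety enters through its normal spaces. At
  \<open>P\<close> of rank at most \<open>r\<close> the directions \<open>A P\<close> and \<open>P B\<close> are tangent, so a normal matrix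
  \<open>D\<close> has \<open>D P\<^sup>T = 0\<close> and \<open>P\<^sup>T D = 0\<close>. If the leading \<open>r \<times> r\<close> block of \<open>P\<close> is
  invertible, these two equations say exactly that \<open>D = (R \<Lambda> L)\<^sup>T\<close> for some \<open>\<Lambda>\<close>
  (\<open>two_sided_normal_block\<close>). Conversely, the \<open>(r+1)\<close>-minors force \<open>L X R = 0\<close> for
  tangent \<open>X\<close> (\<open>tangent_space_annihilated\<close>), so every \<open>(R \<Lambda> L)\<^sup>T\<close> is normal.

  Hence, for \<open>U\<close> with nonzero entries and entry sum, solutions with invertible \<open>P\<^sub>1\<close>
  give the critical points with invertible leading block, and it remains to see
  that generically no solution and no critical point lies outside this chart. For solutions this is the hypersurface statement with \<open>h = det P\<^sub>1\<close>. A critical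
  point of rank \<open>r\<close> has some nonzero \<open>r\<close>-minor, so after permuting rows and columns it does lie
  in the chart and comes from some \<open>X\<close>. The leading minor of the unpermuted matrix is another
  polynomial \<open>h\<close> in \<open>X\<close>, not identically zero, and for generic \<open>U\<close> it does not vanish.
  Only finitely many permutations occur, so finitely many hypersurfaces are excluded.
\<close>

section \<open>Monomials and algebraic dependence\<close>

lemma zero_row_det_0:
  fixes A :: "'a :: comm_ring_1 mat"
  assumes "A \<in> carrier_mat n n" "k < n" "\<And>j. j < n \<Longrightarrow> A $$ (k, j) = 0"
  shows "det A = 0"
proof -
  have "(\<Prod>i = 0..<n. A $$ (i, p i)) = 0" if "p permutes {0..<n}" for p
  proof (rule prod_zero)
    have "p k < n" using permutes_in_image[OF that, of k] assms(2) by simp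
    thus "\<exists>i\<in>{0..<n}. A $$ (i, p i) = 0" using assms by (intro bexI[of _ k]) auto
  qed simp
  thus ?thesis unfolding det_def'[OF assms(1)] by (intro sum.neutral) auto
qed

text \<open>Padding the coefficient matrix with zero rows makes it square and singular, so it has a
  nonzero kernel vector.\<close>

lemma underdetermined_nontrivial:
  fixes a :: "'k \<Rightarrow> 'j \<Rightarrow> 'a :: idom"
  assumes "finite J" "finite K" "card J < card K"
  shows "\<exists>c. (\<exists>k\<in>K. c k \<noteq> 0) \<and> (\<forall>j\<in>J. (\<Sum>k\<in>K. c k * a k j) = 0)"
proof -
  obtain fK where fK: "bij_betw fK {0..<card K} K" using assms(2) ex_bij_betw_nat_finite by blast
  obtain fJ where fJ: "bij_betw fJ {0..<card J} J" using assms(1) ex_bij_betw_nat_finite by blast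
  define N where "N = card K"
  define M where "M = mat N N (\<lambda>(i, l). if i < card J then a (fK l) (fJ i) else 0)"
  have M: "M \<in> carrier_mat N N" by (simp add: M_def)
  have "det M = 0"
    by (rule zero_row_det_0[OF M, of "card J"]) (use assms(3) in \<open>auto simp: M_def N_def\<close>)
  then obtain v where v: "v \<in> carrier_vec N" "v \<noteq> 0\<^sub>v N" "M *\<^sub>v v = 0\<^sub>v N"
    using det_0_iff_vec_prod_zero[OF M] by blast
  define idx where "idx = the_inv_into {0..<N} fK"
  have idx: "idx (fK l) = l" if "l < N" for l
    using that fK unfolding idx_def N_def bij_betw_def by (simp add: the_inv_into_f_f)
  obtain l where l: "l < N" "v $ l \<noteq> 0" using v(1,2) by (metis carrier_vecD eq_vecI index_zero_vec)
  show ?thesis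
  proof (intro exI[of _ "\<lambda>k. v $ (idx k)"] conjI ballI)
    show "\<exists>k\<in>K. v $ idx k \<noteq> 0"
      using l idx fK by (intro bexI[of _ "fK l"]) (auto simp: bij_betw_def N_def)
    fix j assume "j \<in> J"
    then obtain i where i: "i < card J" "j = fJ i" using fJ unfolding bij_betw_def by force
    have iN: "i < N" using i assms(3) N_def by simp
    have "(\<Sum>k\<in>K. v $ idx k * a k j) = (\<Sum>l = 0..<N. v $ idx (fK l) * a (fK l) j)"
      using sum.reindex_bij_betw[OF fK, of "\<lambda>k. v $ idx k * a k j"] N_def by simp
    also have "\<dots> = (\<Sum>l = 0..<N. M $$ (i, l) * v $ l)"
      by (intro sum.cong) (use i iN idx in \<open>auto simp: M_def\<close>)
    also have "\<dots> = (M *\<^sub>v v) $ i"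
      using iN v(1) M by (auto simp: scalar_prod_def intro!: sum.cong)
    also have "\<dots> = 0" using v(3) iN by simp
    finally show "(\<Sum>k\<in>K. v $ idx k * a k j) = 0" .
  qed
qed

definition monom_fun :: "'i set \<Rightarrow> ('i \<Rightarrow> nat) \<Rightarrow> ('i \<Rightarrow> complex) \<Rightarrow> complex" where
  "monom_fun I e x = (\<Prod>p\<in>I. x p ^ e p)"

definition exponents :: "'i set \<Rightarrow> nat \<Rightarrow> ('i \<Rightarrow> nat) set" where
  "exponents I D = PiE I (\<lambda>_. {..D})"

text \<open>Polynomials whose degree in each single variable is at most \<open>D\<close>. Bounding the degrees
  variable by variable, rather than the total degree, makes the monomials a product set that is
  trivial to count.\<close>

definition poly_box :: "'i set \<Rightarrow> nat \<Rightarrow> (('i \<Rightarrow> complex) \<Rightarrow> complex) set" where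
  "poly_box I D = {f. \<exists>c. f = (\<lambda>x. \<Sum>e\<in>exponents I D. c e * monom_fun I e x)}"

lemma finite_exponents: "finite I \<Longrightarrow> finite (exponents I D)"
  unfolding exponents_def by (intro finite_PiE) auto

lemma card_exponents: "finite I \<Longrightarrow> card (exponents I D) = (D + 1) ^ card I"
  unfolding exponents_def by (simp add: card_PiE)

lemma monom_fun_in_poly_box:
  assumes "finite I" "\<And>p. p \<in> I \<Longrightarrow> e p \<le> D"
  shows "monom_fun I e \<in> poly_box I D"
proof -
  obtain e' where e'_def: "e' = restrict e I" by blast
  have e: "e' \<in> exponents I D" using assms(2) by (auto simp: exponents_def e'_def)
  have eq: "monom_fun I e x = monom_fun I e' x" for x
    unfolding monom_fun_def e'_def by (intro prod.cong) auto
  have "monom_fun I e = (\<lambda>x. \<Sum>e''\<in>exponents I D. (if e'' = e' then 1 else 0) * monom_fun I e'' x)"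
    using e finite_exponents[OF assms(1), of D]
    by (simp add: eq[abs_def] if_distrib[of "\<lambda>c. c * _"] sum.delta cong: if_cong)
  thus ?thesis unfolding poly_box_def mem_Collect_eq by (intro exI)
qed

lemma poly_box_add:
  assumes "f \<in> poly_box I D" "g \<in> poly_box I D"
  shows "(\<lambda>x. f x + g x) \<in> poly_box I D"
proof -
  obtain a b where "f = (\<lambda>x. \<Sum>e\<in>exponents I D. a e * monom_fun I e x)"
    "g = (\<lambda>x. \<Sum>e\<in>exponents I D. b e * monom_fun I e x)"
    using assms unfolding poly_box_def by blast
  hence "(\<lambda>x. f x + g x) = (\<lambda>x. \<Sum>e\<in>exponents I D. (a e + b e) * monom_fun I e x)"
    by (simp add: sum.distrib distrib_right)
  thus ?thesis unfolding poly_box_def mem_Collect_eq by (intro exI[of _ "\<lambda>e. a e + b e"])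
qed

lemma poly_box_scale:
  assumes "f \<in> poly_box I D"
  shows "(\<lambda>x. s * f x) \<in> poly_box I D"
proof -
  obtain a where "f = (\<lambda>x. \<Sum>e\<in>exponents I D. a e * monom_fun I e x)"
    using assms unfolding poly_box_def by blast
  hence "(\<lambda>x. s * f x) = (\<lambda>x. \<Sum>e\<in>exponents I D. (s * a e) * monom_fun I e x)"
    by (simp add: sum_distrib_left mult.assoc)
  thus ?thesis unfolding poly_box_def mem_Collect_eq by (intro exI[of _ "\<lambda>e. s * a e"])
qed

lemma poly_box_sum:
  assumes "finite K" "\<And>k. k \<in> K \<Longrightarrow> f k \<in> poly_box I D"
  shows "(\<lambda>x. \<Sum>k\<in>K. f k x) \<in> poly_box I D"
  using assms
proof (induction K rule: finite_induct)
  case empty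
  show ?case unfolding poly_box_def by (auto intro!: exI[of _ "\<lambda>_. 0"])
qed (simp add: poly_box_add)

text \<open>Expanding the product gives scalar multiples of monomials with exponent vectors \<open>e + e'\<close>; no
  collection of like terms is needed because a box is closed under sums.\<close>

lemma poly_box_mult:
  assumes I: "finite I" and f: "f \<in> poly_box I D" and g: "g \<in> poly_box I D'"
  shows "(\<lambda>x. f x * g x) \<in> poly_box I (D + D')"
proof -
  obtain a b where ab: "f = (\<lambda>x. \<Sum>e\<in>exponents I D. a e * monom_fun I e x)"
    "g = (\<lambda>x. \<Sum>e\<in>exponents I D'. b e * monom_fun I e x)"
    using f g unfolding poly_box_def by blast
  have "(\<lambda>x. f x * g x) = (\<lambda>x. \<Sum>e\<in>exponents I D. \<Sum>e'\<in>exponents I D'.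
      (a e * b e') * monom_fun I (\<lambda>p. e p + e' p) x)"
    by (simp add: ab sum_product monom_fun_def power_add prod.distrib mult_ac)
  also have "\<dots> \<in> poly_box I (D + D')"
    by (intro poly_box_sum poly_box_scale monom_fun_in_poly_box finite_exponents I)
       (auto simp: exponents_def PiE_iff intro: add_mono)
  finally show ?thesis .
qed

lemma poly_box_const: "finite I \<Longrightarrow> (\<lambda>x. s) \<in> poly_box I D"
  using poly_box_scale[OF monom_fun_in_poly_box[of I "\<lambda>_. 0" D], of s] by (simp add: monom_fun_def)

lemma poly_box_mono:
  assumes "finite I" "f \<in> poly_box I D" "D \<le> D'"
  shows "f \<in> poly_box I D'"
  using poly_box_mult[OF assms(1,2) poly_box_const[OF assms(1), of 1 "D' - D"]] assms(3) by simp

lemma poly_box_power: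
  assumes "finite I" "f \<in> poly_box I D"
  shows "(\<lambda>x. f x ^ k) \<in> poly_box I (k * D)"
proof (induction k)
  case 0
  show ?case using poly_box_const[OF assms(1)] by simp
next
  case (Suc k)
  show ?case using poly_box_mult[OF assms Suc] by simp
qed

lemma poly_box_prod:
  assumes "finite I" "finite K" "\<And>k. k \<in> K \<Longrightarrow> f k \<in> poly_box I D"
  shows "(\<lambda>x. \<Prod>k\<in>K. f k x) \<in> poly_box I (card K * D)"
  using assms(2,3)
proof (induction K rule: finite_induct)
  case empty
  show ?case using poly_box_const[OF assms(1)] by simp
next
  case (insert k K)
  thus ?case using poly_box_mult[OF assms(1), of "f k" D "\<lambda>x. \<Prod>k\<in>K. f k x" "card K * D"] by simp
qed

text \<open>Induction on the set of variables: collected by powers of one variable, the sum is a univariate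
  polynomial with infinitely many zeros, so each of its coefficients vanishes, and these are sums
  of the same kind in the remaining variables.\<close>

lemma monom_fun_independent:
  assumes "finite I" "\<And>x. (\<Sum>e\<in>exponents I D. c e * monom_fun I e x) = 0" "e \<in> exponents I D"
  shows "c e = 0"
  using assms
proof (induction I arbitrary: c e rule: finite_induct)
  case empty
  thus ?case by (simp add: exponents_def monom_fun_def)
next
  case (insert p I)
  have ex: "exponents (insert p I) D = (\<lambda>(k, e). e(p := k)) ` ({..D} \<times> exponents I D)"
    unfolding exponents_def PiE_insert_eq ..
  have inj: "inj_on (\<lambda>(k, e). e(p := k)) ({..D} \<times> exponents I D)"
    unfolding exponents_def using insert.hyps(2) by (rule inj_combinator)
  have mon: "monom_fun (insert p I) (e(p := k)) x = x p ^ k * monom_fun I e x" for e k x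
  proof -
    have "(\<Prod>q\<in>I. x q ^ (e(p := k)) q) = (\<Prod>q\<in>I. x q ^ e q)"
      using insert.hyps(2) by (intro prod.cong) auto
    thus ?thesis using insert.hyps by (simp add: monom_fun_def)
  qed
  have split: "(\<Sum>k\<le>D. (\<Sum>e\<in>exponents I D. c (e(p := k)) * monom_fun I e x) * t ^ k) = 0" for x t
  proof -
    have I: "monom_fun I e (x(p := t)) = monom_fun I e x" for e
      using insert.hyps(2) unfolding monom_fun_def by (intro prod.cong) auto
    have "0 = (\<Sum>e\<in>exponents (insert p I) D. c e * monom_fun (insert p I) e (x(p := t)))"
      using insert.prems(1) by simp
    also have "\<dots> = (\<Sum>k\<le>D. \<Sum>e\<in>exponents I D. c (e(p := k)) * (t ^ k * monom_fun I e x))"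
      unfolding ex sum.reindex[OF inj] by (simp add: sum.cartesian_product case_prod_unfold mon I)
    also have "\<dots> = (\<Sum>k\<le>D. (\<Sum>e\<in>exponents I D. c (e(p := k)) * monom_fun I e x) * t ^ k)"
      by (simp add: sum_distrib_left mult_ac)
    finally show ?thesis by simp
  qed
  have zero: "(\<Sum>e\<in>exponents I D. c (e(p := k)) * monom_fun I e x) = 0" if "k \<le> D" for k x
    using iffD1[OF polyfun_eq_0 allI[OF split[of x]]] that by simp
  obtain k e' where e': "k \<le> D" "e' \<in> exponents I D" "e = e'(p := k)"
    using insert.prems(2) unfolding ex by auto
  show ?case using insert.IH[of "\<lambda>e. c (e(p := k))", OF zero[OF e'(1)] e'(2)] by (simp only: e'(3))
qed

text \<open>Algebraic dependence of \<open>N + 1\<close> polynomials in \<open>N\<close> variables, by counting. There are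
  \<open>(D + 1)\<^bsup>N + 1\<^esup>\<close> monomials of degree at most \<open>D\<close> in each of the \<open>N + 1\<close>
  polynomials, and all of them lie in a space spanned by \<open>O(D\<^bsup>N\<^esup>)\<close> monomials in the
  variables. For large \<open>D\<close> they are linearly dependent.\<close>

lemma poly_box_dependent:
  assumes I: "finite I" and h: "h \<in> poly_box I d" and \<phi>: "\<And>p. p \<in> I \<Longrightarrow> \<phi> p \<in> poly_box I d"
  shows "\<exists>D c. (\<exists>k\<le>D. \<exists>e\<in>exponents I D. c k e \<noteq> 0) \<and>
    (\<forall>x. (\<Sum>k\<le>D. h x ^ k * (\<Sum>e\<in>exponents I D. c k e * monom_fun I e (\<lambda>p. \<phi> p x))) = 0)"
proof -
  define N where "N = card I"
  \<comment> \<open>Monomials of degree at most \<open>D\<close> in the \<open>N + 1\<close> polynomials lie in the box of size \<open>B\<close>, and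
    \<open>B + 1 \<le> (d (N + 1) + 1) (D + 1)\<close>. The choice of \<open>D\<close> makes the \<open>N\<close>-th power of this
    \<open>D (D + 1) ^ N\<close>, less than the number \<open>(D + 1) ^ (N + 1)\<close> of monomials.\<close>
  define D where "D = (d * (N + 1) + 1) ^ N"
  define B where "B = D * d + N * (D * d)"
  define K where "K = {..D} \<times> exponents I D"
  have box: "(\<lambda>x. h x ^ k * monom_fun I e (\<lambda>p. \<phi> p x)) \<in> poly_box I B"
    if "k \<le> D" "e \<in> exponents I D" for k e
    unfolding B_def
  proof (rule poly_box_mult[OF I])
    show "(\<lambda>x. h x ^ k) \<in> poly_box I (D * d)"
      by (rule poly_box_mono[OF I poly_box_power[OF I h]]) (use that in auto)
    have ep: "e p \<le> D" if "p \<in> I" for p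
      using \<open>e \<in> exponents I D\<close> that by (auto simp: exponents_def PiE_iff)
    show "(\<lambda>x. monom_fun I e (\<lambda>p. \<phi> p x)) \<in> poly_box I (N * (D * d))"
      unfolding monom_fun_def N_def
      by (rule poly_box_prod[OF I I])
         (rule poly_box_mono[OF I poly_box_power[OF I \<phi>]], use ep in auto)
  qed
  have "\<exists>a. \<forall>k\<le>D. \<forall>e\<in>exponents I D. (\<lambda>x. h x ^ k * monom_fun I e (\<lambda>p. \<phi> p x)) =
      (\<lambda>x. \<Sum>e'\<in>exponents I B. a (k, e) e' * monom_fun I e' x)"
  proof -
    have "\<forall>ke. \<exists>a. fst ke \<le> D \<longrightarrow> snd ke \<in> exponents I D \<longrightarrow>
      (\<lambda>x. h x ^ fst ke * monom_fun I (snd ke) (\<lambda>p. \<phi> p x)) =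
      (\<lambda>x. \<Sum>e'\<in>exponents I B. a e' * monom_fun I e' x)"
      using box unfolding poly_box_def by simp
    from choice[OF this] obtain a where "\<forall>ke. fst ke \<le> D \<longrightarrow> snd ke \<in> exponents I D \<longrightarrow>
      (\<lambda>x. h x ^ fst ke * monom_fun I (snd ke) (\<lambda>p. \<phi> p x)) =
      (\<lambda>x. \<Sum>e'\<in>exponents I B. a ke e' * monom_fun I e' x)" by (elim exE)
    thus ?thesis by (intro exI[of _ a]) simp
  qed
  then obtain a where "\<forall>k\<le>D. \<forall>e\<in>exponents I D. (\<lambda>x. h x ^ k * monom_fun I e (\<lambda>p. \<phi> p x)) =
      (\<lambda>x. \<Sum>e'\<in>exponents I B. a (k, e) e' * monom_fun I e' x)" by (elim exE)
  hence a: "h x ^ k * monom_fun I e (\<lambda>p. \<phi> p x) = (\<Sum>e'\<in>exponents I B. a (k, e) e' * monom_fun I e' x)"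
    if "k \<le> D" "e \<in> exponents I D" for k e x
    using that by (simp add: fun_eq_iff)
  have card: "card (exponents I B) < card K"
  proof -
    have "B + 1 \<le> (d * (N + 1) + 1) * (D + 1)" by (simp add: B_def algebra_simps)
    hence "(B + 1) ^ N \<le> ((d * (N + 1) + 1) * (D + 1)) ^ N" by (rule power_mono) simp
    also have "\<dots> = D * (D + 1) ^ N" by (simp only: D_def power_mult_distrib)
    also have "\<dots> < (D + 1) * (D + 1) ^ N" by simp
    finally show ?thesis by (simp add: K_def card_exponents[OF I] card_cartesian_product N_def)
  qed
  have finK: "finite K" using finite_exponents[OF I] by (simp add: K_def)
  obtain c where c: "\<exists>ke\<in>K. c ke \<noteq> 0" "\<And>e'. e' \<in> exponents I B \<Longrightarrow> (\<Sum>ke\<in>K. c ke * a ke e') = 0"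
    using underdetermined_nontrivial[OF finite_exponents[OF I] finK card, of a] by blast
  show ?thesis
  proof (rule exI[of _ D], rule exI[of _ "\<lambda>k e. c (k, e)"], rule conjI[OF _ allI])
    show "\<exists>k\<le>D. \<exists>e\<in>exponents I D. c (k, e) \<noteq> 0" using c(1) by (force simp: K_def)
    fix x
    have "(\<Sum>k\<le>D. h x ^ k * (\<Sum>e\<in>exponents I D. c (k, e) * monom_fun I e (\<lambda>p. \<phi> p x)))
        = (\<Sum>k\<le>D. \<Sum>e\<in>exponents I D. c (k, e) * (h x ^ k * monom_fun I e (\<lambda>p. \<phi> p x)))"
      by (simp add: sum_distrib_left mult_ac)
    also have "\<dots> = (\<Sum>k\<le>D. \<Sum>e\<in>exponents I D. c (k, e) *
        (\<Sum>e'\<in>exponents I B. a (k, e) e' * monom_fun I e' x))"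
      by (intro sum.cong refl) (simp add: a)
    also have "\<dots> = (\<Sum>ke\<in>K. c ke * (\<Sum>e'\<in>exponents I B. a ke e' * monom_fun I e' x))"
      by (simp only: K_def sum.cartesian_product case_prod_unfold prod.collapse)
    also have "\<dots> = (\<Sum>ke\<in>K. \<Sum>e'\<in>exponents I B. c ke * a ke e' * monom_fun I e' x)"
      by (simp only: sum_distrib_left mult.assoc)
    also have "\<dots> = (\<Sum>e'\<in>exponents I B. (\<Sum>ke\<in>K. c ke * a ke e') * monom_fun I e' x)"
      by (subst sum.swap) (simp add: sum_distrib_right)
    also have "\<dots> = 0" using c(2) by simp
    finally show "(\<Sum>k\<le>D. h x ^ k * (\<Sum>e\<in>exponents I D. c (k, e) * monom_fun I e (\<lambda>p. \<phi> p x))) = 0" .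
  qed
qed

section \<open>Polynomial self-maps and generic data\<close>

lemma poly_funs_sum:
  assumes "finite K" "\<And>k. k \<in> K \<Longrightarrow> f k \<in> poly_funs m n"
  shows "(\<lambda>A. \<Sum>k\<in>K. f k A) \<in> poly_funs m n"
  using assms by (induction K rule: finite_induct) (auto intro: poly_funs.intros)

lemma poly_funs_prod:
  assumes "finite K" "\<And>k. k \<in> K \<Longrightarrow> f k \<in> poly_funs m n"
  shows "(\<lambda>A. \<Prod>k\<in>K. f k A) \<in> poly_funs m n"
  using assms by (induction K rule: finite_induct) (auto intro: poly_funs.intros)

lemma poly_funs_power: "f \<in> poly_funs m n \<Longrightarrow> (\<lambda>A. f A ^ k) \<in> poly_funs m n"
  by (induction k) (auto intro: poly_funs.intros)

abbreviation positions :: "nat \<Rightarrow> nat \<Rightarrow> (nat \<times> nat) set" where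
  "positions m n \<equiv> {..<m} \<times> {..<n}"

lemma poly_funs_monom: "(\<lambda>A. monom_fun (positions m n) e (($$) A)) \<in> poly_funs m n"
  unfolding monom_fun_def
  by (intro poly_funs_prod poly_funs_power) (auto intro: poly_funs.entry)

lemma poly_funs_box:
  assumes "f \<in> poly_funs m n"
  shows "\<exists>D. \<exists>g\<in>poly_box (positions m n) D. \<forall>A. f A = g (($$) A)"
  using assms
proof (induction rule: poly_funs.induct)
  case (const c)
  show ?case by (intro exI[of _ 0] bexI[OF _ poly_box_const[of _ c]]) auto
next
  case (entry i j)
  have "(\<lambda>x. x (i, j)) = monom_fun (positions m n) (\<lambda>p. if p = (i, j) then 1 else 0)"
    using entry by (simp add: monom_fun_def fun_eq_iff if_distrib prod.delta cong: if_cong)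
  hence "(\<lambda>x. x (i, j)) \<in> poly_box (positions m n) 1"
    by (simp only:) (rule monom_fun_in_poly_box, auto)
  thus ?case by (intro exI[of _ 1] bexI[of _ "\<lambda>x. x (i, j)"]) auto
next
  case (add f g)
  then obtain D f' D' g' where fg: "f' \<in> poly_box (positions m n) D" "\<forall>A. f A = f' (($$) A)"
    "g' \<in> poly_box (positions m n) D'" "\<forall>A. g A = g' (($$) A)" by blast
  have "f' \<in> poly_box (positions m n) (D + D')" "g' \<in> poly_box (positions m n) (D + D')"
    by (rule poly_box_mono[OF _ fg(1)] poly_box_mono[OF _ fg(3)]; simp)+
  from poly_box_add[OF this] show ?case using fg by (intro exI bexI) auto
next
  case (mult f g)
  then obtain D f' D' g' where fg: "f' \<in> poly_box (positions m n) D" "\<forall>A. f A = f' (($$) A)"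
    "g' \<in> poly_box (positions m n) D'" "\<forall>A. g A = g' (($$) A)" by blast
  from poly_box_mult[OF _ fg(1,3)] show ?case using fg by (intro exI bexI) auto
qed

text \<open>Restricted to a line, a polynomial function becomes a univariate polynomial; this reduces
  the next lemma to the absence of zero divisors in \<open>\<complex>[t]\<close>.\<close>

lemma poly_funs_line:
  assumes "f \<in> poly_funs m n"
  shows "\<exists>q. \<forall>t. f (mat m n (\<lambda>p. A $$ p + t * (B $$ p - A $$ p))) = poly q t"
  using assms
proof (induction rule: poly_funs.induct)
  case (const c)
  show ?case by (intro exI[of _ "[:c:]"]) simp
next
  case (entry i j)
  thus ?case by (intro exI[of _ "[:A $$ (i, j), B $$ (i, j) - A $$ (i, j):]"]) simp
next
  case (add f g)
  then obtain q q' where "\<forall>t. f (mat m n (\<lambda>p. A $$ p + t * (B $$ p - A $$ p))) = poly q t"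
    "\<forall>t. g (mat m n (\<lambda>p. A $$ p + t * (B $$ p - A $$ p))) = poly q' t" by blast
  thus ?case by (intro exI[of _ "q + q'"]) simp
next
  case (mult f g)
  then obtain q q' where "\<forall>t. f (mat m n (\<lambda>p. A $$ p + t * (B $$ p - A $$ p))) = poly q t"
    "\<forall>t. g (mat m n (\<lambda>p. A $$ p + t * (B $$ p - A $$ p))) = poly q' t" by blast
  thus ?case by (intro exI[of _ "q * q'"]) simp
qed

text \<open>Both functions are nonzero polynomials on the line through \<open>A\<close> and \<open>B\<close>, so their product
  is nonzero there too. This is the irreducibility of affine space.\<close>

lemma poly_funs_domain:
  assumes f: "f \<in> poly_funs m n" "A \<in> carrier_mat m n" "f A \<noteq> 0"
    and g: "g \<in> poly_funs m n" "B \<in> carrier_mat m n" "g B \<noteq> 0"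
  shows "\<exists>C\<in>carrier_mat m n. f C \<noteq> 0 \<and> g C \<noteq> 0"
proof -
  define C where "C = (\<lambda>t. mat m n (\<lambda>p. A $$ p + t * (B $$ p - A $$ p)))"
  obtain q q' where q: "\<And>t. f (C t) = poly q t" "\<And>t. g (C t) = poly q' t"
    using poly_funs_line[OF f(1), of A B] poly_funs_line[OF g(1), of A B] unfolding C_def by blast
  have "C 0 = A" "C 1 = B" using f(2) g(2) by (auto simp: C_def)
  hence "poly q 0 \<noteq> 0" "poly q' 1 \<noteq> 0" using q[symmetric] f(3) g(3) by auto
  hence "q * q' \<noteq> 0" by auto
  then obtain t where "poly (q * q') t \<noteq> 0" using poly_all_0_iff_0 by blast
  thus ?thesis using q by (intro bexI[of _ "C t"]) (auto simp: C_def)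
qed

text \<open>A proper Zariski closed set lies in the zero set of a single polynomial that does not vanish
  identically, so genericity can be tested with hypersurfaces.\<close>

lemma for_generic_iff:
  "for_generic m n Q \<longleftrightarrow>
    (\<exists>g\<in>poly_funs m n. (\<exists>A\<in>carrier_mat m n. g A \<noteq> 0) \<and> (\<forall>U\<in>carrier_mat m n. g U \<noteq> 0 \<longrightarrow> Q U))"
proof
  assume "for_generic m n Q"
  then obtain F where F: "F \<subseteq> poly_funs m n" "{A \<in> carrier_mat m n. \<forall>f\<in>F. f A = 0} \<subset> carrier_mat m n"
    "\<forall>U \<in> carrier_mat m n - {A \<in> carrier_mat m n. \<forall>f\<in>F. f A = 0}. Q U"
    unfolding for_generic_def zariski_closed_def by blast
  then obtain A g where "A \<in> carrier_mat m n" "g \<in> F" "g A \<noteq> 0" by blast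
  thus "\<exists>g\<in>poly_funs m n. (\<exists>A\<in>carrier_mat m n. g A \<noteq> 0) \<and> (\<forall>U\<in>carrier_mat m n. g U \<noteq> 0 \<longrightarrow> Q U)"
    using F by (intro bexI[of _ g]) auto
next
  assume "\<exists>g\<in>poly_funs m n. (\<exists>A\<in>carrier_mat m n. g A \<noteq> 0) \<and> (\<forall>U\<in>carrier_mat m n. g U \<noteq> 0 \<longrightarrow> Q U)"
  then obtain g A where g: "g \<in> poly_funs m n" "A \<in> carrier_mat m n" "g A \<noteq> 0"
    "\<forall>U\<in>carrier_mat m n. g U \<noteq> 0 \<longrightarrow> Q U" by blast
  show "for_generic m n Q"
    unfolding for_generic_def zariski_closed_def
    by (rule exI[of _ "{A \<in> carrier_mat m n. \<forall>f\<in>{g}. f A = 0}"]) (use g in blast)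
qed

lemma for_generic_mono:
  assumes "for_generic m n Q" "\<And>U. U \<in> carrier_mat m n \<Longrightarrow> Q U \<Longrightarrow> Q' U"
  shows "for_generic m n Q'"
  using assms unfolding for_generic_iff by blast

lemma for_generic_conj:
  assumes "for_generic m n Q" "for_generic m n Q'"
  shows "for_generic m n (\<lambda>U. Q U \<and> Q' U)"
proof -
  obtain g A where g: "g \<in> poly_funs m n" "A \<in> carrier_mat m n" "g A \<noteq> 0"
    "\<forall>U\<in>carrier_mat m n. g U \<noteq> 0 \<longrightarrow> Q U" using assms(1) unfolding for_generic_iff by blast
  obtain h B where h: "h \<in> poly_funs m n" "B \<in> carrier_mat m n" "h B \<noteq> 0"
    "\<forall>U\<in>carrier_mat m n. h U \<noteq> 0 \<longrightarrow> Q' U" using assms(2) unfolding for_generic_iff by blast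
  obtain C where "C \<in> carrier_mat m n" "g C \<noteq> 0" "h C \<noteq> 0"
    using poly_funs_domain[OF g(1-3) h(1-3)] by blast
  thus ?thesis unfolding for_generic_iff
    using g(4) h(4) by (intro bexI[OF _ poly_funs.mult[OF g(1) h(1)]]) auto
qed

lemma for_generic_ball:
  assumes "finite K" "\<And>k. k \<in> K \<Longrightarrow> for_generic m n (Q k)"
  shows "for_generic m n (\<lambda>U. \<forall>k\<in>K. Q k U)"
  using assms
proof (induction K rule: finite_induct)
  case empty
  show ?case unfolding for_generic_iff
    by (intro bexI[of _ "\<lambda>_. 1"]) (auto intro: poly_funs.const bexI[of _ "0\<^sub>m m n"])
next
  case (insert k K)
  have "for_generic m n (\<lambda>U. Q k U \<and> (\<forall>k\<in>K. Q k U))"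
    by (rule for_generic_conj) (use insert in auto)
  thus ?case by simp
qed

text \<open>The carrier condition is required for every argument, also outside the carrier: the
  dimensions of a matrix product are read off from its factors, and with fixed dimensions its
  entries are literally polynomial functions.\<close>

definition poly_map :: "nat \<Rightarrow> nat \<Rightarrow> nat \<Rightarrow> nat \<Rightarrow> (complex mat \<Rightarrow> complex mat) \<Rightarrow> bool" where
  "poly_map m n p q F \<longleftrightarrow> (\<forall>X. F X \<in> carrier_mat p q) \<and>
     (\<forall>i<p. \<forall>j<q. (\<lambda>X. F X $$ (i, j)) \<in> poly_funs m n)"

text \<open>The relation is written as a polynomial in \<open>h\<close> with coefficients \<open>g k\<close> evaluated at
  \<open>\<Phi> X\<close>. That some \<open>g k\<close> is nonzero as a function is the independence of monomials.\<close>

lemma algebraic_dependence: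
  assumes h: "h \<in> poly_funs m n"
    and \<Phi>: "poly_map m n m n \<Phi>"
  shows "\<exists>D g. (\<forall>k. g k \<in> poly_funs m n) \<and> (\<exists>k\<le>D. \<exists>U\<in>carrier_mat m n. g k U \<noteq> 0) \<and>
    (\<forall>X. (\<Sum>k\<le>D. h X ^ k * g k (\<Phi> X)) = 0)"
proof -
  let ?I = "positions m n"
  have fin: "finite ?I" by simp
  obtain d0 h' where h': "h' \<in> poly_box ?I d0" "\<And>A. h A = h' (($$) A)"
    using poly_funs_box[OF h] by blast
  have "\<forall>p. \<exists>D g. p \<in> ?I \<longrightarrow> g \<in> poly_box ?I D \<and> (\<forall>A. \<Phi> A $$ p = g (($$) A))"
  proof
    fix p :: "nat \<times> nat"
    show "\<exists>D g. p \<in> ?I \<longrightarrow> g \<in> poly_box ?I D \<and> (\<forall>A. \<Phi> A $$ p = g (($$) A))"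
    proof (cases "p \<in> ?I")
      case True
      hence "(\<lambda>A. \<Phi> A $$ p) \<in> poly_funs m n" using \<Phi> by (cases p) (auto simp: poly_map_def)
      thus ?thesis using poly_funs_box by fastforce
    qed simp
  qed
  then obtain dp \<phi> where \<phi>: "\<And>p. p \<in> ?I \<Longrightarrow> \<phi> p \<in> poly_box ?I (dp p)"
    "\<And>p A. p \<in> ?I \<Longrightarrow> \<Phi> A $$ p = \<phi> p (($$) A)" by metis
  define d where "d = d0 + (\<Sum>p\<in>?I. dp p)"
  have hd: "h' \<in> poly_box ?I d" by (rule poly_box_mono[OF fin h'(1)]) (simp add: d_def)
  have \<phi>d: "\<phi> p \<in> poly_box ?I d" if "p \<in> ?I" for p
  proof (rule poly_box_mono[OF fin \<phi>(1)[OF that]])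
    show "dp p \<le> d" using member_le_sum[OF that, of dp] fin by (simp add: d_def)
  qed
  obtain D c where c: "\<exists>k\<le>D. \<exists>e\<in>exponents ?I D. c k e \<noteq> 0"
    "\<And>x. (\<Sum>k\<le>D. h' x ^ k * (\<Sum>e\<in>exponents ?I D. c k e * monom_fun ?I e (\<lambda>p. \<phi> p x))) = 0"
    using poly_box_dependent[where \<phi> = \<phi>, OF fin hd \<phi>d] by blast
  define g where "g k A = (\<Sum>e\<in>exponents ?I D. c k e * monom_fun ?I e (($$) A))" for k A
  have mon: "monom_fun ?I e (\<lambda>p. \<phi> p (($$) X)) = monom_fun ?I e (($$) (\<Phi> X))" for e X
    unfolding monom_fun_def by (intro prod.cong refl) (simp add: \<phi>(2))
  show ?thesis
  proof (rule exI[of _ D], rule exI[of _ g], intro conjI allI)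
    show "g k \<in> poly_funs m n" for k
      unfolding g_def[abs_def]
      by (intro poly_funs_sum finite_exponents poly_funs.mult poly_funs.const poly_funs_monom) simp
    show "(\<Sum>k\<le>D. h X ^ k * g k (\<Phi> X)) = 0" for X
      using c(2)[of "($$) X"] by (simp add: g_def h'(2) mon)
    obtain k e where ke: "k \<le> D" "e \<in> exponents ?I D" "c k e \<noteq> 0" using c(1) by blast
    have "\<exists>x. (\<Sum>e\<in>exponents ?I D. c k e * monom_fun ?I e x) \<noteq> 0"
      using monom_fun_independent[OF fin, of "c k" D e] ke by blast
    then obtain x where x: "(\<Sum>e\<in>exponents ?I D. c k e * monom_fun ?I e x) \<noteq> 0" by blast
    have "monom_fun ?I e (($$) (mat m n x)) = monom_fun ?I e x" for e
      unfolding monom_fun_def by (intro prod.cong) auto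
    hence "g k (mat m n x) \<noteq> 0" using x by (simp add: g_def)
    thus "\<exists>k\<le>D. \<exists>U\<in>carrier_mat m n. g k U \<noteq> 0" using ke(1) by (intro exI[of _ k]) auto
  qed
qed

lemma poly_funs_compose:
  assumes "poly_map m n p q F" "f \<in> poly_funs p q"
  shows "(\<lambda>X. f (F X)) \<in> poly_funs m n"
  using assms(2,1) unfolding poly_map_def
  by (induction rule: poly_funs.induct) (auto intro: poly_funs.intros)

text \<open>Let \<open>g k0\<close> be the first nonzero coefficient in the dependence relation. The factor
  \<open>h ^ k0\<close> can be cancelled since \<open>h\<close> is not the zero polynomial, and what remains has constant
  term \<open>g k0 (\<Phi> X)\<close>. So \<open>h X = 0\<close> implies \<open>g k0 (\<Phi> X) = 0\<close>.\<close>

lemma generic_avoids_image_of_hypersurface: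
  assumes \<Phi>: "poly_map m n m n \<Phi>" and h: "h \<in> poly_funs m n" "A \<in> carrier_mat m n" "h A \<noteq> 0"
  shows "for_generic m n (\<lambda>U. \<forall>X\<in>carrier_mat m n. \<Phi> X = U \<longrightarrow> h X \<noteq> 0)"
proof -
  have \<Phi>_carrier: "\<And>X. \<Phi> X \<in> carrier_mat m n"
    using \<Phi> by (auto simp: poly_map_def)
  from algebraic_dependence[OF h(1) \<Phi>] obtain D g
    where "(\<forall>k. g k \<in> poly_funs m n) \<and> (\<exists>k\<le>D. \<exists>U\<in>carrier_mat m n. g k U \<noteq> 0) \<and>
      (\<forall>X. (\<Sum>k\<le>D. h X ^ k * g k (\<Phi> X)) = 0)" by (elim exE)
  hence g: "\<And>k. g k \<in> poly_funs m n" "\<exists>k\<le>D. \<exists>U\<in>carrier_mat m n. g k U \<noteq> 0"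
    "\<And>X. (\<Sum>k\<le>D. h X ^ k * g k (\<Phi> X)) = 0" by simp_all
  define k0 where "k0 = (LEAST k. \<exists>U\<in>carrier_mat m n. g k U \<noteq> 0)"
  have k0: "\<exists>U\<in>carrier_mat m n. g k0 U \<noteq> 0"
    unfolding k0_def by (rule LeastI_ex) (use g(2) in blast)
  obtain k1 where k1: "k1 \<le> D" "\<exists>U\<in>carrier_mat m n. g k1 U \<noteq> 0" using g(2) by blast
  have k0D: "k0 \<le> D"
    using Least_le[of "\<lambda>k. \<exists>U\<in>carrier_mat m n. g k U \<noteq> 0", OF k1(2)] k1(1)
    unfolding k0_def by (rule le_trans)
  have low: "g k U = 0" if "k < k0" "U \<in> carrier_mat m n" for k U
    using not_less_Least[OF that(1)[unfolded k0_def]] that(2) by blast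
  define q where "q X = (\<Sum>k\<in>{k0..D}. h X ^ (k - k0) * g k (\<Phi> X))" for X
  have q_poly: "q \<in> poly_funs m n"
    unfolding q_def[abs_def]
    by (intro poly_funs_sum poly_funs.mult poly_funs_power h(1) poly_funs_compose[OF \<Phi> g(1)]) simp
  have hq: "h X ^ k0 * q X = 0" for X
  proof -
    have "0 = (\<Sum>k\<le>D. h X ^ k * g k (\<Phi> X))" using g(3) by simp
    also have "\<dots> = (\<Sum>k\<in>{k0..D}. h X ^ k * g k (\<Phi> X))"
      by (rule sum.mono_neutral_right) (auto simp: low[OF _ \<Phi>_carrier])
    also have "\<dots> = h X ^ k0 * q X"
      unfolding q_def sum_distrib_left
      by (intro sum.cong refl) (simp add: mult.assoc[symmetric] power_add[symmetric])
    finally show ?thesis by simp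
  qed
  have q0: "q X = 0" if "X \<in> carrier_mat m n" for X
    using poly_funs_domain[OF h q_poly that] hq by fastforce
  show ?thesis unfolding for_generic_iff
  proof (intro bexI[OF _ g(1)[of k0]] conjI ballI impI notI)
    show "\<exists>U\<in>carrier_mat m n. g k0 U \<noteq> 0" by (rule k0)
    fix U X assume U: "g k0 U \<noteq> 0" "X \<in> carrier_mat m n" "\<Phi> X = U" "h X = 0"
    have "q X = (\<Sum>k\<in>{k0}. h X ^ (k - k0) * g k (\<Phi> X))"
      unfolding q_def using U(4) k0D by (intro sum.mono_neutral_right) auto
    thus False using q0[OF U(2)] U(1,3) by simp
  qed
qed

text \<open>Each coordinate \<open>X $$ p\<close> is algebraic over the components of \<open>\<Phi>\<close>: on the fibre over \<open>U\<close>
  it is a root of the univariate polynomial with coefficients \<open>g k U\<close>, which is nonzero for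
  generic \<open>U\<close>.\<close>

lemma generic_finite_fibre:
  assumes \<Phi>: "poly_map m n m n \<Phi>"
  shows "for_generic m n (\<lambda>U. finite {X \<in> carrier_mat m n. \<Phi> X = U})"
proof -
  have entry: "for_generic m n (\<lambda>U. finite ((\<lambda>X. X $$ p) ` {X \<in> carrier_mat m n. \<Phi> X = U}))"
    if p: "p \<in> positions m n" for p
  proof -
    have "(\<lambda>X. X $$ p) \<in> poly_funs m n"
      using poly_funs.entry[of "fst p" m "snd p" n] p by (simp add: mem_Times_iff)
    from algebraic_dependence[OF this \<Phi>] obtain D g
      where "(\<forall>k. g k \<in> poly_funs m n) \<and> (\<exists>k\<le>D. \<exists>U\<in>carrier_mat m n. g k U \<noteq> 0) \<and>
        (\<forall>X. (\<Sum>k\<le>D. (X $$ p) ^ k * g k (\<Phi> X)) = 0)" by (elim exE)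
    hence g: "\<And>k. g k \<in> poly_funs m n" "\<exists>k\<le>D. \<exists>U\<in>carrier_mat m n. g k U \<noteq> 0"
      "\<And>X. (\<Sum>k\<le>D. (X $$ p) ^ k * g k (\<Phi> X)) = 0" by simp_all
    obtain k where k: "k \<le> D" "\<exists>U\<in>carrier_mat m n. g k U \<noteq> 0" using g(2) by blast
    show ?thesis unfolding for_generic_iff
    proof (intro bexI[OF _ g(1)[of k]] conjI ballI impI k(2))
      fix U assume "g k U \<noteq> 0"
      hence "finite {t. (\<Sum>k\<le>D. g k U * t ^ k) = 0}"
        using polyfun_finite_roots[of "\<lambda>k. g k U" D] k(1) by blast
      moreover have "(\<lambda>X. X $$ p) ` {X \<in> carrier_mat m n. \<Phi> X = U} \<subseteq> {t. (\<Sum>k\<le>D. g k U * t ^ k) = 0}"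
        using g(3) by (auto simp: mult.commute)
      ultimately show "finite ((\<lambda>X. X $$ p) ` {X \<in> carrier_mat m n. \<Phi> X = U})"
        by (rule rev_finite_subset)
    qed
  qed
  have "for_generic m n (\<lambda>U. \<forall>p\<in>positions m n. finite ((\<lambda>X. X $$ p) ` {X \<in> carrier_mat m n. \<Phi> X = U}))"
    by (rule for_generic_ball) (use entry in auto)
  thus ?thesis
  proof (rule for_generic_mono)
    fix U assume fin: "\<forall>p\<in>positions m n. finite ((\<lambda>X. X $$ p) ` {X \<in> carrier_mat m n. \<Phi> X = U})"
    let ?S = "{X \<in> carrier_mat m n. \<Phi> X = U}"
    have "?S \<subseteq> mat m n ` PiE (positions m n) (\<lambda>p. (\<lambda>X. X $$ p) ` ?S)"
    proof
      fix X assume X: "X \<in> ?S"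
      have "X = mat m n (restrict (($$) X) (positions m n))" using X by (intro eq_matI) auto
      moreover have "restrict (($$) X) (positions m n) \<in> PiE (positions m n) (\<lambda>p. (\<lambda>X. X $$ p) ` ?S)"
        using X by auto
      ultimately show "X \<in> mat m n ` PiE (positions m n) (\<lambda>p. (\<lambda>X. X $$ p) ` ?S)" by blast
    qed
    moreover have "finite (PiE (positions m n) (\<lambda>p. (\<lambda>X. X $$ p) ` ?S))"
      by (rule finite_PiE) (use fin in auto)
    ultimately show "finite ?S" by (meson finite_imageI finite_subset)
  qed
qed

section \<open>Rank, minors and the block form\<close>

lemma obtain_mat_inverse:
  fixes A :: "'a :: field mat"
  assumes "A \<in> carrier_mat n n" "det A \<noteq> 0"
  obtains B where "B \<in> carrier_mat n n" "A * B = 1\<^sub>m n" "B * A = 1\<^sub>m n"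
proof
  note adj = adj_mat[OF assms(1)]
  let ?B = "(1 / det A) \<cdot>\<^sub>m adj_mat A"
  show "?B \<in> carrier_mat n n" using adj(1) by simp
  have one: "(1 / det A) \<cdot>\<^sub>m (det A \<cdot>\<^sub>m 1\<^sub>m n) = 1\<^sub>m n"
    using assms(2) by (intro eq_matI) auto
  show "A * ?B = 1\<^sub>m n" "?B * A = 1\<^sub>m n"
    unfolding mult_smult_distrib[OF assms(1) adj(1)] mult_smult_assoc_mat[OF adj(1) assms(1)] adj(2,3) one
    by (rule refl)+
qed

text \<open>Padding both factors with zeros to square matrices leaves the product unchanged and gives the
  second factor a zero row.\<close>

lemma det_mult_narrow:
  fixes B C :: "'a :: idom mat"
  assumes "B \<in> carrier_mat p k" "C \<in> carrier_mat k p" "k < p"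
  shows "det (B * C) = 0"
proof -
  define B' where "B' = mat p p (\<lambda>(i, j). if j < k then B $$ (i, j) else 0)"
  define C' where "C' = mat p p (\<lambda>(i, j). if i < k then C $$ (i, j) else 0)"
  have car: "B' \<in> carrier_mat p p" "C' \<in> carrier_mat p p" by (auto simp: B'_def C'_def)
  have "B * C = B' * C'"
  proof (rule eq_matI)
    fix i j assume "i < dim_row (B' * C')" "j < dim_col (B' * C')"
    hence ij: "i < p" "j < p" using car by auto
    have "(\<Sum>l = 0..<p. B' $$ (i, l) * C' $$ (l, j)) = (\<Sum>l = 0..<k. B' $$ (i, l) * C' $$ (l, j))"
      using assms(3) ij by (intro sum.mono_neutral_right) (auto simp: B'_def)
    also have "\<dots> = (\<Sum>l = 0..<k. B $$ (i, l) * C $$ (l, j))"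
      using assms(3) ij by (intro sum.cong) (auto simp: B'_def C'_def)
    finally show "(B * C) $$ (i, j) = (B' * C') $$ (i, j)"
      using ij assms car by (simp add: scalar_prod_def)
  qed (use assms car in auto)
  moreover have "det C' = 0"
    by (rule zero_row_det_0[OF car(2) assms(3)]) (use assms(3) in \<open>auto simp: C'_def\<close>)
  ultimately show ?thesis using det_mult[OF car] by simp
qed

text \<open>If more than \<open>k\<close> columns of \<open>B * C\<close> were independent, the corresponding columns of \<open>C\<close>, which
  have only \<open>k\<close> entries, would still satisfy a nontrivial linear relation, and \<open>B\<close> carries it over.\<close>

lemma (in vec_space) rank_mult_le_inner_dim:
  assumes B: "B \<in> carrier_mat n k" and C: "C \<in> carrier_mat k nc"
  shows "rank (B * C) \<le> k"
proof (rule ccontr)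
  assume "\<not> rank (B * C) \<le> k"
  have BC: "B * C \<in> carrier_mat n nc" using B C by simp
  obtain S where S: "maximal S (\<lambda>T. T \<subseteq> set (cols (B * C)) \<and> lin_indpt T)"
    using maximal_exists_superset[of "set (cols (B * C))" "\<lambda>T. T \<subseteq> set (cols (B * C)) \<and> lin_indpt T" "{}"]
      lindep_span[of "{}"] finite_lin_indpt2[of "{}"] by auto
  have sub: "S \<subseteq> set (cols (B * C))" and ind: "lin_indpt S" using S by (auto simp: maximal_def)
  have large: "k < card S"
    using rank_card_indpt[OF BC S] \<open>\<not> rank (B * C) \<le> k\<close> by simp
  obtain xs where xs: "set xs = S" "distinct xs"
    using finite_distinct_list[of S] sub finite_subset by blast
  define D where "D = mat_of_cols n xs"
  have vecs: "set xs \<subseteq> carrier_vec n" using xs sub cols_dim[of "B * C"] B by auto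
  have D: "D \<in> carrier_mat n (length xs)" "cols D = xs" using vecs by (auto simp: D_def)
  have "\<forall>j. \<exists>v. j < length xs \<longrightarrow> v \<in> carrier_vec k \<and> xs ! j = B *\<^sub>v v"
  proof
    fix j
    show "\<exists>v. j < length xs \<longrightarrow> v \<in> carrier_vec k \<and> xs ! j = B *\<^sub>v v"
    proof (cases "j < length xs")
      case True
      hence "xs ! j \<in> set (cols (B * C))" using xs sub by auto
      then obtain l where l: "l < nc" "xs ! j = col (B * C) l"
        using BC by (auto simp: cols_def)
      have "xs ! j = B *\<^sub>v col C l" unfolding l(2) by (rule col_mult2[OF B C l(1)])
      thus ?thesis using C by (metis col_dim carrier_matD(1))
    qed simp
  qed
  then obtain v where v: "\<And>j. j < length xs \<Longrightarrow> v j \<in> carrier_vec k"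
    "\<And>j. j < length xs \<Longrightarrow> xs ! j = B *\<^sub>v v j" by metis
  define E where "E = mat_of_cols k (map v [0..<length xs])"
  have E: "E \<in> carrier_mat k (length xs)"
    using mat_of_cols_carrier(1)[of k "map v [0..<length xs]"] by (simp only: E_def length_map length_upt diff_zero)
  have DBE: "D = B * E"
  proof (rule mat_col_eqI)
    fix j assume "j < dim_col (B * E)"
    hence j: "j < length xs" using E by simp
    have "col E j = v j" using j v(1) by (simp add: E_def)
    moreover have "xs ! j \<in> carrier_vec n" using j vecs by auto
    ultimately show "col D j = col (B * E) j"
      unfolding col_mult2[OF B E j] using j v(2)[OF j] by (simp add: D_def)
  qed (use B D E in auto)
  obtain c where c: "\<exists>j<length xs. c j \<noteq> 0" "\<And>i. i < k \<Longrightarrow> (\<Sum>j<length xs. c j * E $$ (i, j)) = 0"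
    using underdetermined_nontrivial[of "{..<k}" "{..<length xs}" "\<lambda>j i. E $$ (i, j)"]
      large xs distinct_card[OF xs(2)] by auto
  define w where "w = vec (length xs) c"
  have w: "w \<in> carrier_vec (length xs)" "w \<noteq> 0\<^sub>v (length xs)"
    using c(1) unfolding w_def by (auto simp: vec_eq_iff)
  have "E *\<^sub>v w = 0\<^sub>v k"
    using c(2) E by (intro eq_vecI)
      (auto simp: w_def scalar_prod_def lessThan_atLeast0 mult.commute)
  moreover have "B *\<^sub>v 0\<^sub>v k = 0\<^sub>v n" using B by (intro eq_vecI) auto
  ultimately have "D *\<^sub>v w = 0\<^sub>v n" using DBE B E w(1) by (simp add: assoc_mult_mat_vec)
  from lin_depI[OF D(1) w this] D(2) xs ind show False by simp
qed

text \<open>The columns of \<open>B\<close> are a maximal independent set of columns of \<open>A\<close>; the columns of \<open>C\<close> are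
  the coordinates of all columns of \<open>A\<close>.\<close>

lemma (in vec_space) rank_factorization:
  assumes A: "A \<in> carrier_mat n nc"
  shows "\<exists>B\<in>carrier_mat n (rank A). \<exists>C\<in>carrier_mat (rank A) nc. A = B * C"
proof -
  obtain S where S: "maximal S (\<lambda>T. T \<subseteq> set (cols A) \<and> lin_indpt T)"
    using maximal_exists_superset[of "set (cols A)" "\<lambda>T. T \<subseteq> set (cols A) \<and> lin_indpt T" "{}"]
      lindep_span[of "{}"] finite_lin_indpt2[of "{}"] by auto
  have sub: "S \<subseteq> set (cols A)" and ind: "lin_indpt S" using S by (auto simp: maximal_def)
  obtain xs where xs: "set xs = S" "distinct xs"
    using finite_distinct_list[of S] sub finite_subset by blast
  have len: "length xs = rank A" using rank_card_indpt[OF A S] distinct_card[OF xs(2)] xs(1) by simp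
  have colsA: "set (cols A) \<subseteq> carrier_vec n" using cols_dim[of A] A by auto
  have vecs: "set xs \<subseteq> carrier_vec n" using xs sub colsA by auto
  define B where "B = mat_of_cols n xs"
  have B: "B \<in> carrier_mat n (rank A)" "cols B = xs" using vecs len by (auto simp: B_def)
  \<comment> \<open>By maximality every column of \<open>A\<close> is in the span of the chosen ones.\<close>
  have "\<exists>w. w \<in> carrier_vec (rank A) \<and> v = B *\<^sub>v w" if v: "v \<in> set (cols A)" for v
  proof -
    have "v \<in> span S"
    proof (cases "v \<in> S")
      case True
      thus ?thesis using span_mem[of S v] sub colsA by auto
    next
      case False
      have "lin_dep (S \<union> {v})"
      proof (rule ccontr)
        assume "lin_indpt (S \<union> {v})"
        hence "S \<union> {v} = S" using S v sub unfolding maximal_def by blast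
        thus False using False by blast
      qed
      thus ?thesis using lin_dep_iff_in_span[of S v] sub colsA v ind False by blast
    qed
    then obtain a where "v = lincomb a (set (cols B))"
      using finite_span[of S] sub colsA finite_subset[OF sub] xs B(2) by auto
    hence "v = B *\<^sub>v vec (rank A) (\<lambda>i. a (col B i))"
      using mat_mult_eq_lincomb[OF B(1)] B(2) xs(2) by simp
    thus ?thesis by (intro exI[of _ "vec (rank A) (\<lambda>i. a (col B i))"]) simp
  qed
  hence "\<forall>v. \<exists>w. v \<in> set (cols A) \<longrightarrow> w \<in> carrier_vec (rank A) \<and> v = B *\<^sub>v w" by blast
  then obtain f where f: "\<And>v. v \<in> set (cols A) \<Longrightarrow> f v \<in> carrier_vec (rank A)"
    "\<And>v. v \<in> set (cols A) \<Longrightarrow> v = B *\<^sub>v f v" by metis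
  define C where "C = mat_of_cols (rank A) (map f (cols A))"
  have C: "C \<in> carrier_mat (rank A) nc" using A by (auto simp: C_def)
  have "A = B * C"
  proof (rule mat_col_eqI)
    fix j assume "j < dim_col (B * C)"
    hence j: "j < nc" using C by simp
    have "col A j \<in> set (cols A)" using j A by (auto simp: cols_def)
    moreover have "col C j = f (col A j)"
      using j f(1) A calculation by (simp add: C_def)
    ultimately show "col A j = col (B * C) j"
      unfolding col_mult2[OF B(1) C j] using f(2) by simp
  qed (use A B C in auto)
  thus ?thesis using B(1) C by blast
qed

text \<open>Rows and columns are selected by functions rather than by sets. Permutations and one-row changes
  of a selection then act by composition and update.\<close>

definition minor :: "'a :: comm_ring_1 mat \<Rightarrow> nat \<Rightarrow> (nat \<Rightarrow> nat) \<Rightarrow> (nat \<Rightarrow> nat) \<Rightarrow> 'a" where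
  "minor A k a b = det (mat k k (\<lambda>(i, j). A $$ (a i, b j)))"

lemma minor_mult_narrow:
  fixes B C :: "'a :: idom mat"
  assumes "B \<in> carrier_mat m k" "C \<in> carrier_mat k n" "k < p"
    "\<And>i. i < p \<Longrightarrow> a i < m" "\<And>i. i < p \<Longrightarrow> b i < n"
  shows "minor (B * C) p a b = 0"
proof -
  have "mat p p (\<lambda>(i, j). (B * C) $$ (a i, b j)) =
      mat p k (\<lambda>(i, l). B $$ (a i, l)) * mat k p (\<lambda>(l, j). C $$ (l, b j))"
    using assms by (intro eq_matI) (auto simp: scalar_prod_def intro!: sum.cong)
  thus ?thesis unfolding minor_def by (simp add: det_mult_narrow[OF _ _ assms(3)])
qed

lemma minor_rank_le:
  fixes A :: "'a :: field mat"
  assumes "A \<in> carrier_mat m n" "minor A p a b \<noteq> 0"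
    "\<And>i. i < p \<Longrightarrow> a i < m" "\<And>i. i < p \<Longrightarrow> b i < n"
  shows "p \<le> vec_space.rank m A"
proof -
  obtain B C where "B \<in> carrier_mat m (vec_space.rank m A)" "C \<in> carrier_mat (vec_space.rank m A) n" "A = B * C"
    using vec_space.rank_factorization[OF assms(1)] by blast
  with minor_mult_narrow[of B m _ C n p a b] assms show ?thesis by (metis leI)
qed

lemma block_P_carrier:
  assumes "P1 \<in> carrier_mat r r" "L1 \<in> carrier_mat (m - r) r" "R1 \<in> carrier_mat r (n - r)" "r \<le> m" "r \<le> n"
  shows "block_P P1 L1 R1 \<in> carrier_mat m n"
  using four_block_carrier_mat[of P1 r r "L1 * P1 * R1" "m - r" "n - r" "P1 * R1" "L1 * P1"] assms
  by (simp add: block_P_def)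

lemma block_P_factorization:
  assumes "P1 \<in> carrier_mat r r" "L1 \<in> carrier_mat (m - r) r" "R1 \<in> carrier_mat r (n - r)" "r \<le> m" "r \<le> n"
  shows "\<exists>B\<in>carrier_mat m r. \<exists>C\<in>carrier_mat r n. block_P P1 L1 R1 = B * C"
proof (intro bexI)
  let ?B = "four_block_mat P1 (0\<^sub>m r 0) (L1 * P1) (0\<^sub>m (m - r) 0)"
  let ?C = "four_block_mat (1\<^sub>m r) R1 (0\<^sub>m 0 r) (0\<^sub>m 0 (n - r))"
  show "?B \<in> carrier_mat m r" "?C \<in> carrier_mat r n"
    using four_block_carrier_mat[of P1 r r "0\<^sub>m (m - r) 0" "m - r" 0]
      four_block_carrier_mat[of "1\<^sub>m r :: complex mat" r r "0\<^sub>m 0 (n - r)" 0 "n - r"] assms by simp_all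
  have "?B * ?C = block_P P1 L1 R1"
    unfolding block_P_def
    by (subst mult_four_block_mat[of _ r r _ 0 _ "m - r" _ _ r _ "n - r"])
       (use assms in \<open>auto simp: left_mult_zero_mat\<close>)
  thus "block_P P1 L1 R1 = ?B * ?C" by simp
qed

text \<open>Schur complements: for each position outside the leading block, a column operation turns the
  bordered \<open>(r+1)\<close>-minor into \<open>det P1\<close> times the corresponding entry of the Schur
  complement of \<open>P1\<close>. Hence this complement vanishes, and that is the block form.\<close>

lemma block_P_if_bordered_minors_vanish:
  assumes P: "P \<in> carrier_mat m n" and r: "r \<le> m" "r \<le> n" and lead: "minor P r id id \<noteq> 0"
    and border: "\<And>i j. r \<le> i \<Longrightarrow> i < m \<Longrightarrow> r \<le> j \<Longrightarrow> j < n \<Longrightarrow> minor P (Suc r) (id(r := i)) (id(r := j)) = 0"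
  shows "\<exists>P1\<in>carrier_mat r r. \<exists>L1\<in>carrier_mat (m - r) r. \<exists>R1\<in>carrier_mat r (n - r).
    P = block_P P1 L1 R1 \<and> det P1 \<noteq> 0"
proof -
  define P1 where "P1 = mat r r (\<lambda>(i, j). P $$ (i, j))"
  define Y where "Y = mat r (n - r) (\<lambda>(i, j). P $$ (i, j + r))"
  define Z where "Z = mat (m - r) r (\<lambda>(i, j). P $$ (i + r, j))"
  have P1: "P1 \<in> carrier_mat r r" and Y: "Y \<in> carrier_mat r (n - r)" and Z: "Z \<in> carrier_mat (m - r) r"
    by (auto simp: P1_def Y_def Z_def)
  have det: "det P1 \<noteq> 0" using lead by (simp add: minor_def P1_def)
  obtain Q where Q: "Q \<in> carrier_mat r r" "P1 * Q = 1\<^sub>m r" "Q * P1 = 1\<^sub>m r"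
    using obtain_mat_inverse[OF P1 det] by blast
  have R: "P1 * (Q * Y) = Y"
    using assoc_mult_mat[OF P1 Q(1) Y] Q(2) Y by simp
  have L: "Z * Q * P1 = Z"
    using assoc_mult_mat[OF Z Q(1) P1] Q(3) Z by simp
  have QY: "Q * Y \<in> carrier_mat r (n - r)" and ZQ: "Z * Q \<in> carrier_mat (m - r) r" using Q Y Z by auto
  have corner: "P $$ (i + r, j + r) = (Z * (Q * Y)) $$ (i, j)" if ij: "i < m - r" "j < n - r" for i j
  proof -
    define c where "c = mat r 1 (\<lambda>(a, b). P $$ (a, j + r))"
    define w where "w = mat 1 r (\<lambda>(a, b). P $$ (i + r, b))"
    define d where "d = mat 1 1 (\<lambda>(a :: nat, b :: nat). P $$ (i + r, j + r))"
    define \<rho> where "\<rho> = mat r 1 (\<lambda>(a, b :: nat). (Q * Y) $$ (a, j))"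
    have car: "c \<in> carrier_mat r 1" "w \<in> carrier_mat 1 r" "d \<in> carrier_mat 1 1" "\<rho> \<in> carrier_mat r 1"
      by (auto simp: c_def w_def d_def \<rho>_def)
    define M where "M = four_block_mat P1 c w d"
    \<comment> \<open>Since \<open>P1 * \<rho> = c\<close>, multiplying by \<open>F\<close> clears the upper part of the last column.\<close>
    define F where "F = four_block_mat (1\<^sub>m r) \<rho> (0\<^sub>m 1 r) (- 1\<^sub>m 1)"
    have MF: "M \<in> carrier_mat (r + 1) (r + 1)" "F \<in> carrier_mat (r + 1) (r + 1)"
      unfolding M_def F_def by (rule four_block_carrier_mat; use P1 car in auto)+
    have "M = mat (Suc r) (Suc r) (\<lambda>(a, b). P $$ ((id(r := i + r)) a, (id(r := j + r)) b))"
      by (rule eq_matI) (auto simp: M_def P1_def c_def w_def d_def)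
    hence "det M = 0"
      using border[of "i + r" "j + r"] ij by (simp add: minor_def)
    hence 0: "det (M * F) = 0" using det_mult[OF MF] by simp
    have P1\<rho>: "P1 * \<rho> = c"
    proof (rule eq_matI)
      fix a b assume "a < dim_row c" "b < dim_col c"
      hence a: "a < r" "b = 0" using car by auto
      have "(P1 * \<rho>) $$ (a, b) = (P1 * (Q * Y)) $$ (a, j)"
        using a ij P1 Q Y by (auto simp: \<rho>_def scalar_prod_def intro!: sum.cong)
      also have "\<dots> = c $$ (a, b)" unfolding R using a ij by (simp add: Y_def c_def)
      finally show "(P1 * \<rho>) $$ (a, b) = c $$ (a, b)" .
    qed (use P1 car in auto)
    have "M * F = four_block_mat (P1 * 1\<^sub>m r + c * 0\<^sub>m 1 r) (P1 * \<rho> + c * (- 1\<^sub>m 1))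
        (w * 1\<^sub>m r + d * 0\<^sub>m 1 r) (w * \<rho> + d * (- 1\<^sub>m 1))"
      unfolding M_def F_def by (rule mult_four_block_mat) (use P1 car in auto)
    also have "\<dots> = four_block_mat P1 (0\<^sub>m r 1) w (w * \<rho> - d)"
      unfolding P1\<rho> using P1 car by (intro cong_four_block_mat) (auto intro!: eq_matI)
    finally have "det (M * F) = det P1 * det (w * \<rho> - d)"
      using det_four_block_mat_upper_right_zero[OF P1 refl car(2), of "w * \<rho> - d"] car
      by (simp add: minus_carrier_mat)
    hence "det (w * \<rho> - d) = 0" using 0 det by simp
    hence "(w * \<rho> - d) $$ (0, 0) = 0" using det_single[of "w * \<rho> - d"] car by (simp add: minus_carrier_mat)
    hence "d $$ (0, 0) = (w * \<rho>) $$ (0, 0)" using car by simp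
    also have "\<dots> = (Z * (Q * Y)) $$ (i, j)"
      using ij Z Q Y by (auto simp: w_def \<rho>_def Z_def scalar_prod_def intro!: sum.cong)
    finally show ?thesis by (simp add: d_def)
  qed
  have ZQPY: "Z * Q * P1 * (Q * Y) = Z * (Q * Y)" by (simp only: L)
  have "P = block_P P1 (Z * Q) (Q * Y)"
    unfolding block_P_def R L
  proof (rule eq_matI)
    fix i j assume "i < dim_row (four_block_mat P1 Y Z (Z * (Q * Y)))" "j < dim_col (four_block_mat P1 Y Z (Z * (Q * Y)))"
    hence ij: "i < m" "j < n" using P1 Y Z r by auto
    show "P $$ (i, j) = four_block_mat P1 Y Z (Z * (Q * Y)) $$ (i, j)"
      using ij r P1 Y Z corner[of "i - r" "j - r"] by (auto simp: P1_def Y_def Z_def)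
  qed (use P P1 Y Z r in auto)
  thus ?thesis using P1 QY ZQ det by blast
qed

lemma block_P_if_rank_le:
  assumes P: "P \<in> carrier_mat m n" and r: "r \<le> m" "r \<le> n" and lead: "minor P r id id \<noteq> 0"
    and rank: "vec_space.rank m P \<le> r"
  shows "\<exists>P1\<in>carrier_mat r r. \<exists>L1\<in>carrier_mat (m - r) r. \<exists>R1\<in>carrier_mat r (n - r).
    P = block_P P1 L1 R1 \<and> det P1 \<noteq> 0"
proof (rule block_P_if_bordered_minors_vanish[OF P r lead])
  fix i j assume ij: "r \<le> i" "i < m" "r \<le> j" "j < n"
  show "minor P (Suc r) (id(r := i)) (id(r := j)) = 0"
  proof (rule ccontr)
    assume "minor P (Suc r) (id(r := i)) (id(r := j)) \<noteq> 0"
    from minor_rank_le[OF P this] ij rank show False by (fastforce split: if_splits)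
  qed
qed

definition permute_mat :: "(nat \<Rightarrow> nat) \<Rightarrow> (nat \<Rightarrow> nat) \<Rightarrow> 'a mat \<Rightarrow> 'a mat" where
  "permute_mat \<sigma> \<tau> A = mat (dim_row A) (dim_col A) (\<lambda>(i, j). A $$ (\<sigma> i, \<tau> j))"

lemma permute_mat_carrier: "A \<in> carrier_mat m n \<Longrightarrow> permute_mat \<sigma> \<tau> A \<in> carrier_mat m n"
  by (simp add: permute_mat_def)

lemma permute_mat_inverse:
  assumes "A \<in> carrier_mat m n" "\<sigma> permutes {..<m}" "\<tau> permutes {..<n}"
  shows "permute_mat (inv_into UNIV \<sigma>) (inv_into UNIV \<tau>) (permute_mat \<sigma> \<tau> A) = A"
proof (rule eq_matI)
  fix i j assume "i < dim_row A" "j < dim_col A"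
  hence ij: "i < m" "j < n" using assms(1) by auto
  have "inv_into UNIV \<sigma> i < m" "inv_into UNIV \<tau> j < n"
    using ij permutes_in_image[OF permutes_inv[OF assms(2)], of i]
      permutes_in_image[OF permutes_inv[OF assms(3)], of j] by auto
  thus "permute_mat (inv_into UNIV \<sigma>) (inv_into UNIV \<tau>) (permute_mat \<sigma> \<tau> A) $$ (i, j) = A $$ (i, j)"
    using ij assms by (simp add: permute_mat_def permutes_inverses)
qed (use assms in \<open>auto simp: permute_mat_def\<close>)

lemma minor_permute_mat:
  assumes "A \<in> carrier_mat m n" "\<And>i. i < k \<Longrightarrow> a i < m" "\<And>i. i < k \<Longrightarrow> b i < n"
  shows "minor (permute_mat \<sigma> \<tau> A) k a b = minor A k (\<sigma> \<circ> a) (\<tau> \<circ> b)"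
  unfolding minor_def by (rule arg_cong[of _ _ det], rule eq_matI) (use assms in \<open>auto simp: permute_mat_def\<close>)

lemma permute_mat_mult:
  fixes B C :: "'a :: comm_semiring_0 mat"
  assumes "B \<in> carrier_mat m k" "C \<in> carrier_mat k n" "\<sigma> permutes {..<m}" "\<tau> permutes {..<n}"
  shows "permute_mat \<sigma> \<tau> (B * C) = permute_mat \<sigma> id B * permute_mat id \<tau> C"
proof (rule eq_matI)
  fix i j assume "i < dim_row (permute_mat \<sigma> id B * permute_mat id \<tau> C)"
    "j < dim_col (permute_mat \<sigma> id B * permute_mat id \<tau> C)"
  hence ij: "i < m" "j < n" using assms by (auto simp: permute_mat_def)
  have "\<sigma> i < m" "\<tau> j < n"
    using ij permutes_in_image[OF assms(3), of i] permutes_in_image[OF assms(4), of j] by auto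
  thus "permute_mat \<sigma> \<tau> (B * C) $$ (i, j) = (permute_mat \<sigma> id B * permute_mat id \<tau> C) $$ (i, j)"
    using ij assms by (auto simp: permute_mat_def scalar_prod_def intro!: sum.cong)
qed (use assms in \<open>auto simp: permute_mat_def\<close>)

text \<open>Take a nonzero minor of maximal size \<open>k\<close>, selected by two permutations. Maximality kills all
  bordered minors: composing with a transposition extends the selection by any further row and
  column. So the permuted matrix has block form with inner dimension \<open>k\<close>, and \<open>k\<close> is the rank.\<close>

lemma rank_minor_exists:
  assumes P: "P \<in> carrier_mat m n"
  shows "\<exists>\<sigma> \<tau>. \<sigma> permutes {..<m} \<and> \<tau> permutes {..<n} \<and>
    vec_space.rank m P \<le> m \<and> vec_space.rank m P \<le> n \<and> minor P (vec_space.rank m P) \<sigma> \<tau> \<noteq> (0 :: complex)"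
proof -
  define good where "good k \<longleftrightarrow> k \<le> m \<and> k \<le> n \<and>
    (\<exists>\<sigma> \<tau>. \<sigma> permutes {..<m} \<and> \<tau> permutes {..<n} \<and> minor P k \<sigma> \<tau> \<noteq> 0)" for k
  have "good 0"
    unfolding good_def by (auto simp: minor_def intro!: exI[of _ id] permutes_id)
  define k where "k = (GREATEST k. good k)"
  have bound: "\<And>l. good l \<Longrightarrow> l \<le> m" by (auto simp: good_def)
  have "good k" unfolding k_def using GreatestI_nat[of good, OF \<open>good 0\<close>] bound by blast
  then obtain \<sigma> \<tau> where k: "k \<le> m" "k \<le> n" and \<sigma>: "\<sigma> permutes {..<m}" and \<tau>: "\<tau> permutes {..<n}"
    and minor: "minor P k \<sigma> \<tau> \<noteq> 0" unfolding good_def by blast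
  have max: "\<not> good (Suc k)"
    using Greatest_le_nat[of good "Suc k" m] bound unfolding k_def by fastforce
  let ?P = "permute_mat \<sigma> \<tau> P"
  have "minor ?P k id id \<noteq> 0" using minor minor_permute_mat[OF P, of k id id] k by simp
  moreover have "minor ?P (Suc k) (id(k := i)) (id(k := j)) = 0"
    if ij: "k \<le> i" "i < m" "k \<le> j" "j < n" for i j
  proof -
    let ?s = "Transposition.transpose k i" and ?t = "Transposition.transpose k j"
    have "minor ?P (Suc k) (id(k := i)) (id(k := j)) = minor P (Suc k) (\<sigma> \<circ> (id(k := i))) (\<tau> \<circ> (id(k := j)))"
      using ij by (intro minor_permute_mat[OF P]) auto
    also have "\<dots> = minor P (Suc k) (\<sigma> \<circ> ?s) (\<tau> \<circ> ?t)"
      unfolding minor_def using ij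
      by (intro arg_cong[of _ _ det] cong_mat) (auto simp: Transposition.transpose_def)
    also have "\<dots> = 0"
    proof -
      have "\<sigma> \<circ> ?s permutes {..<m}" "\<tau> \<circ> ?t permutes {..<n}"
        using ij \<sigma> \<tau> by (auto intro!: permutes_compose permutes_swap_id)
      thus ?thesis using max ij k unfolding good_def by fastforce
    qed
    finally show ?thesis .
  qed
  ultimately obtain P1 L1 R1 where block: "P1 \<in> carrier_mat k k" "L1 \<in> carrier_mat (m - k) k"
    "R1 \<in> carrier_mat k (n - k)" "?P = block_P P1 L1 R1"
    using block_P_if_bordered_minors_vanish[OF permute_mat_carrier[OF P] k] by blast
  obtain B C where BC: "B \<in> carrier_mat m k" "C \<in> carrier_mat k n" "?P = B * C"
    using block_P_factorization[OF block(1-3) k] block(4) by auto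
  have "P = permute_mat (inv_into UNIV \<sigma>) id B * permute_mat id (inv_into UNIV \<tau>) C"
    using permute_mat_inverse[OF P \<sigma> \<tau>] permute_mat_mult[OF BC(1,2) permutes_inv[OF \<sigma>] permutes_inv[OF \<tau>]] BC(3)
    by simp
  hence "vec_space.rank m P \<le> k"
    using vec_space.rank_mult_le_inner_dim[OF permute_mat_carrier[OF BC(1)] permute_mat_carrier[OF BC(2)]] by metis
  moreover have "k \<le> vec_space.rank m P"
    by (rule minor_rank_le[OF P minor])
       (use k permutes_in_image[OF \<sigma>] permutes_in_image[OF \<tau>] in auto)
  ultimately have "vec_space.rank m P = k" by simp
  thus ?thesis using \<sigma> \<tau> k minor by auto
qed

text \<open>The block form factors through dimension \<open>r\<close>, and its leading \<open>r\<close>-minor is nonzero.\<close>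

lemma block_P_rank:
  assumes "P1 \<in> carrier_mat r r" "L1 \<in> carrier_mat (m - r) r" "R1 \<in> carrier_mat r (n - r)" "r \<le> m" "r \<le> n"
    and "det P1 \<noteq> 0"
  shows "vec_space.rank m (block_P P1 L1 R1) = r"
proof (rule antisym)
  show "vec_space.rank m (block_P P1 L1 R1) \<le> r"
    using block_P_factorization[OF assms(1-5)] vec_space.rank_mult_le_inner_dim by metis
  have "mat r r (\<lambda>(i, j). block_P P1 L1 R1 $$ (i, j)) = P1"
    using assms by (intro eq_matI) (auto simp: block_P_def)
  hence "minor (block_P P1 L1 R1) r id id \<noteq> 0" using assms(6) by (simp add: minor_def)
  from minor_rank_le[OF block_P_carrier[OF assms(1-5)] this]
  show "r \<le> vec_space.rank m (block_P P1 L1 R1)" using assms(4,5) by auto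
qed

section \<open>Tangent and normal spaces of the determinantal variety\<close>

lemma sum_lessThan_split:
  fixes f :: "nat \<Rightarrow> 'a :: comm_monoid_add"
  assumes "r \<le> m"
  shows "(\<Sum>a<m. f a) = (\<Sum>a<r. f a) + (\<Sum>a<m - r. f (a + r))"
proof -
  have "(\<Sum>a<m. f a) = (\<Sum>a<r. f a) + (\<Sum>a\<in>{r..<m}. f a)"
    using assms by (subst sum.union_disjoint[symmetric]) (auto intro!: sum.cong)
  also have "(\<Sum>a\<in>{r..<m}. f a) = (\<Sum>a<m - r. f (a + r))"
    using sum.shift_bounds_nat_ivl[of f 0 r "m - r"] assms by (simp add: lessThan_atLeast0)
  finally show ?thesis .
qed

lemma mult_entry:
  assumes "A \<in> carrier_mat p q" "B \<in> carrier_mat q s" "i < p" "j < s"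
  shows "(A * B) $$ (i, j) = (\<Sum>k<q. A $$ (i, k) * B $$ (k, j))"
  using assms by (simp add: scalar_prod_def lessThan_atLeast0)

lemma trace_comm:
  fixes A B :: "'a :: comm_semiring_0 mat"
  assumes "A \<in> carrier_mat p q" "B \<in> carrier_mat q p"
  shows "(\<Sum>i<p. (A * B) $$ (i, i)) = (\<Sum>j<q. (B * A) $$ (j, j))"
proof -
  have "(\<Sum>i<p. (A * B) $$ (i, i)) = (\<Sum>i<p. \<Sum>j<q. A $$ (i, j) * B $$ (j, i))"
    by (intro sum.cong refl mult_entry[OF assms]) auto
  also have "\<dots> = (\<Sum>j<q. \<Sum>i<p. B $$ (j, i) * A $$ (i, j))"
    by (subst sum.swap) (simp add: mult.commute)
  also have "\<dots> = (\<Sum>j<q. (B * A) $$ (j, j))"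
    by (intro sum.cong refl mult_entry[OF assms(2,1), symmetric]) auto
  finally show ?thesis .
qed

lemma block_L_carrier: "L1 \<in> carrier_mat (m - r) r \<Longrightarrow> r \<le> m \<Longrightarrow> block_L L1 \<in> carrier_mat (m - r) m"
  unfolding block_L_def append_cols_def by auto

lemma block_R_carrier: "R1 \<in> carrier_mat r (n - r) \<Longrightarrow> r \<le> n \<Longrightarrow> block_R R1 \<in> carrier_mat n (n - r)"
  unfolding block_R_def append_rows_def by auto

lemma block_L_entry:
  assumes "L1 \<in> carrier_mat (m - r) r" "i < m - r" "j < m"
  shows "block_L L1 $$ (i, j) = (if j < r then L1 $$ (i, j) else if j = i + r then - 1 else 0)"
  using assms unfolding block_L_def append_cols_def by auto

lemma block_R_entry:
  assumes "R1 \<in> carrier_mat r (n - r)" "i < n" "j < n - r"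
  shows "block_R R1 $$ (i, j) = (if i < r then R1 $$ (i, j) else if i = j + r then - 1 else 0)"
  using assms unfolding block_R_def append_rows_def by auto

lemma block_L_mult:
  assumes L1: "L1 \<in> carrier_mat (m - r) r" and r: "r \<le> m" and M: "M \<in> carrier_mat m q"
    and ij: "i < m - r" "j < q"
  shows "(block_L L1 * M) $$ (i, j) = (\<Sum>k<r. L1 $$ (i, k) * M $$ (k, j)) - M $$ (i + r, j)"
proof -
  have "(block_L L1 * M) $$ (i, j) = (\<Sum>k<r. L1 $$ (i, k) * M $$ (k, j)) +
      (\<Sum>k<m - r. (if k = i then - M $$ (k + r, j) else 0))"
    unfolding mult_entry[OF block_L_carrier[OF L1 r] M ij] sum_lessThan_split[OF r]
    using L1 r ij by (intro arg_cong2[of _ _ _ _ "(+)"] sum.cong) (auto simp: block_L_entry)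
  thus ?thesis using ij by simp
qed

lemma mult_block_R:
  assumes R1: "R1 \<in> carrier_mat r (n - r)" and r: "r \<le> n" and M: "M \<in> carrier_mat q n"
    and ij: "i < q" "j < n - r"
  shows "(M * block_R R1) $$ (i, j) = (\<Sum>k<r. M $$ (i, k) * R1 $$ (k, j)) - M $$ (i, j + r)"
proof -
  have "(M * block_R R1) $$ (i, j) = (\<Sum>k<r. M $$ (i, k) * R1 $$ (k, j)) +
      (\<Sum>k<n - r. (if k = j then - M $$ (i, k + r) else 0))"
    unfolding mult_entry[OF M block_R_carrier[OF R1 r] ij] sum_lessThan_split[OF r]
    using R1 r ij by (intro arg_cong2[of _ _ _ _ "(+)"] sum.cong) (auto simp: block_R_entry)
  thus ?thesis using ij by simp
qed

lemma mult_block_L: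
  assumes L1: "L1 \<in> carrier_mat (m - r) r" and r: "r \<le> m" and M: "M \<in> carrier_mat q (m - r)"
    and ij: "i < q" "j < m"
  shows "(M * block_L L1) $$ (i, j) = (if j < r then \<Sum>k<m - r. M $$ (i, k) * L1 $$ (k, j) else - M $$ (i, j - r))"
proof -
  have "(M * block_L L1) $$ (i, j) = (\<Sum>k<m - r. if j < r then M $$ (i, k) * L1 $$ (k, j)
      else if k = j - r then - M $$ (i, k) else 0)"
    unfolding mult_entry[OF M block_L_carrier[OF L1 r] ij]
    using L1 r ij by (intro sum.cong) (auto simp: block_L_entry)
  thus ?thesis using ij by auto
qed

lemma block_R_mult:
  assumes R1: "R1 \<in> carrier_mat r (n - r)" and r: "r \<le> n" and M: "M \<in> carrier_mat (n - r) q"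
    and ij: "i < n" "j < q"
  shows "(block_R R1 * M) $$ (i, j) = (if i < r then \<Sum>k<n - r. R1 $$ (i, k) * M $$ (k, j) else - M $$ (i - r, j))"
proof -
  have "(block_R R1 * M) $$ (i, j) = (\<Sum>k<n - r. if i < r then R1 $$ (i, k) * M $$ (k, j)
      else if k = i - r then - M $$ (k, j) else 0)"
    unfolding mult_entry[OF block_R_carrier[OF R1 r] M ij]
    using R1 r ij by (intro sum.cong) (auto simp: block_R_entry)
  thus ?thesis using ij by auto
qed

lemma block_P_entry:
  assumes "P1 \<in> carrier_mat r r" "L1 \<in> carrier_mat (m - r) r" "R1 \<in> carrier_mat r (n - r)" "r \<le> m" "r \<le> n"
    "i < m" "j < n"
  shows "block_P P1 L1 R1 $$ (i, j) =
    (if i < r then if j < r then P1 $$ (i, j) else \<Sum>l<r. P1 $$ (i, l) * R1 $$ (l, j - r)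
     else if j < r then \<Sum>k<r. L1 $$ (i - r, k) * P1 $$ (k, j)
     else \<Sum>l<r. (\<Sum>k<r. L1 $$ (i - r, k) * P1 $$ (k, l)) * R1 $$ (l, j - r))"
proof -
  have LP: "L1 * P1 \<in> carrier_mat (m - r) r" using assms by auto
  have "(L1 * P1 * R1) $$ (a, b) = (\<Sum>l<r. (\<Sum>k<r. L1 $$ (a, k) * P1 $$ (k, l)) * R1 $$ (l, b))"
    if "a < m - r" "b < n - r" for a b
    unfolding mult_entry[OF LP assms(3) that]
    by (intro sum.cong refl arg_cong2[of _ _ _ _ "(*)"] mult_entry[OF assms(2,1)]) (use that in auto)
  moreover have "(L1 * P1) $$ (a, b) = (\<Sum>k<r. L1 $$ (a, k) * P1 $$ (k, b))" if "a < m - r" "b < r" for a b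
    by (rule mult_entry[OF assms(2,1) that])
  moreover have "(P1 * R1) $$ (a, b) = (\<Sum>k<r. P1 $$ (a, k) * R1 $$ (k, b))" if "a < r" "b < n - r" for a b
    by (rule mult_entry[OF assms(1,3) that])
  ultimately show ?thesis using assms unfolding block_P_def
    by (subst index_mat_four_block) (auto simp del: index_mult_mat(1))
qed

lemma block_L_mult_block_P:
  assumes "P1 \<in> carrier_mat r r" "L1 \<in> carrier_mat (m - r) r" "R1 \<in> carrier_mat r (n - r)" "r \<le> m" "r \<le> n"
  shows "block_L L1 * block_P P1 L1 R1 = 0\<^sub>m (m - r) n"
proof (rule eq_matI)
  note P = block_P_carrier[OF assms]
  show "dim_row (block_L L1 * block_P P1 L1 R1) = dim_row (0\<^sub>m (m - r) n)"
    "dim_col (block_L L1 * block_P P1 L1 R1) = dim_col (0\<^sub>m (m - r) n)"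
    using block_L_carrier[OF assms(2,4)] P by auto
  fix i j assume "i < dim_row (0\<^sub>m (m - r) n)" "j < dim_col (0\<^sub>m (m - r) n)"
  hence ij: "i < m - r" "j < n" by auto
  have "(\<Sum>k<r. L1 $$ (i, k) * (\<Sum>l<r. P1 $$ (k, l) * R1 $$ (l, b))) =
      (\<Sum>l<r. (\<Sum>k<r. L1 $$ (i, k) * P1 $$ (k, l)) * R1 $$ (l, b))" for b
    unfolding sum_distrib_left sum_distrib_right by (subst sum.swap) (simp add: mult.assoc)
  thus "(block_L L1 * block_P P1 L1 R1) $$ (i, j) = 0\<^sub>m (m - r) n $$ (i, j)"
    using ij assms by (simp add: block_L_mult[OF assms(2,4) P ij] block_P_entry)
qed

lemma block_P_mult_block_R:
  assumes "P1 \<in> carrier_mat r r" "L1 \<in> carrier_mat (m - r) r" "R1 \<in> carrier_mat r (n - r)" "r \<le> m" "r \<le> n"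
  shows "block_P P1 L1 R1 * block_R R1 = 0\<^sub>m m (n - r)"
proof (rule eq_matI)
  note P = block_P_carrier[OF assms]
  show "dim_row (block_P P1 L1 R1 * block_R R1) = dim_row (0\<^sub>m m (n - r))"
    "dim_col (block_P P1 L1 R1 * block_R R1) = dim_col (0\<^sub>m m (n - r))"
    using block_R_carrier[OF assms(3,5)] P by auto
  fix i j assume "i < dim_row (0\<^sub>m m (n - r))" "j < dim_col (0\<^sub>m m (n - r))"
  hence ij: "i < m" "j < n - r" by auto
  thus "(block_P P1 L1 R1 * block_R R1) $$ (i, j) = 0\<^sub>m m (n - r) $$ (i, j)"
    using assms by (simp add: mult_block_R[OF assms(3,5) P ij] block_P_entry)
qed

text \<open>The direction \<open>E P\<close> with the matrix unit \<open>E\<close> at position \<open>(i, k)\<close>. The whole line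
  \<open>P + t E P = (1 + t E) P\<close> consists of matrices of rank at most that of \<open>P\<close>, so a polynomial
  that vanishes on the variety is constant along it.\<close>

lemma tangent_space_row:
  assumes P: "P \<in> carrier_mat m n" "vec_space.rank m P \<le> r" and "i < m" "k < m"
  shows "mat m n (\<lambda>(a, b). if a = i then P $$ (k, b) else 0) \<in> tangent_space m n (determinantal_variety m n r) P"
    (is "?X \<in> _")
proof -
  obtain B C where BC: "B \<in> carrier_mat m (vec_space.rank m P)" "C \<in> carrier_mat (vec_space.rank m P) n" "P = B * C"
    using vec_space.rank_factorization[OF P(1)] by blast
  define q where "q = vec_space.rank m P"
  note BC = BC[folded q_def]
  have "P + t \<cdot>\<^sub>m ?X \<in> determinantal_variety m n r" for t
  proof -
    define B' where "B' = mat m q (\<lambda>(a, l). B $$ (a, l) + (if a = i then t * B $$ (k, l) else 0))"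
    have B': "B' \<in> carrier_mat m q" by (simp add: B'_def)
    have "P + t \<cdot>\<^sub>m ?X = B' * C"
    proof (rule eq_matI)
      fix a b assume "a < dim_row (B' * C)" "b < dim_col (B' * C)"
      hence ab: "a < m" "b < n" using B' BC by auto
      show "(P + t \<cdot>\<^sub>m ?X) $$ (a, b) = (B' * C) $$ (a, b)"
        unfolding mult_entry[OF B' BC(2) ab] using ab assms(3,4) BC(1,2)
        by (auto simp: BC(3) mult_entry[OF BC(1,2)] B'_def sum_distrib_left distrib_right sum.distrib
            mult.assoc simp del: index_mult_mat(1))
    qed (use B' BC P in auto)
    moreover have "vec_space.rank m (B' * C) \<le> r"
      using vec_space.rank_mult_le_inner_dim[OF B' BC(2)] P(2) q_def by simp
    ultimately show ?thesis using B' BC unfolding determinantal_variety_def by auto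
  qed
  thus ?thesis unfolding tangent_space_def by auto
qed

text \<open>The direction \<open>P E\<close>, where \<open>E\<close> is the matrix unit at position \<open>(l, j)\<close>.\<close>

lemma tangent_space_col:
  assumes P: "P \<in> carrier_mat m n" "vec_space.rank m P \<le> r" and "j < n" "l < n"
  shows "mat m n (\<lambda>(a, b). if b = j then P $$ (a, l) else 0) \<in> tangent_space m n (determinantal_variety m n r) P"
    (is "?X \<in> _")
proof -
  obtain B C where BC: "B \<in> carrier_mat m (vec_space.rank m P)" "C \<in> carrier_mat (vec_space.rank m P) n" "P = B * C"
    using vec_space.rank_factorization[OF P(1)] by blast
  define q where "q = vec_space.rank m P"
  note BC = BC[folded q_def]
  have "P + t \<cdot>\<^sub>m ?X \<in> determinantal_variety m n r" for t
  proof -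
    define C' where "C' = mat q n (\<lambda>(k, b). C $$ (k, b) + (if b = j then t * C $$ (k, l) else 0))"
    have C': "C' \<in> carrier_mat q n" by (simp add: C'_def)
    have "P + t \<cdot>\<^sub>m ?X = B * C'"
    proof (rule eq_matI)
      fix a b assume "a < dim_row (B * C')" "b < dim_col (B * C')"
      hence ab: "a < m" "b < n" using C' BC by auto
      show "(P + t \<cdot>\<^sub>m ?X) $$ (a, b) = (B * C') $$ (a, b)"
        unfolding mult_entry[OF BC(1) C' ab] using ab assms(3,4) BC(1,2)
        by (auto simp: BC(3) mult_entry[OF BC(1,2)] C'_def sum_distrib_left distrib_left sum.distrib
            mult.left_commute simp del: index_mult_mat(1))
    qed (use C' BC P in auto)
    moreover have "vec_space.rank m (B * C') \<le> r"
      using vec_space.rank_mult_le_inner_dim[OF BC(1) C'] P(2) q_def by simp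
    ultimately show ?thesis using C' BC unfolding determinantal_variety_def by auto
  qed
  thus ?thesis unfolding tangent_space_def by auto
qed

text \<open>The matrix equations \<open>D P\<^sup>T = 0\<close> and \<open>P\<^sup>T D = 0\<close>, entry by entry. Unlike the block
  form, this description is visibly invariant under permutations of rows and columns.\<close>

definition two_sided_normal :: "nat \<Rightarrow> nat \<Rightarrow> complex mat \<Rightarrow> complex mat \<Rightarrow> bool" where
  "two_sided_normal m n P D \<longleftrightarrow>
     (\<forall>i<m. \<forall>k<m. (\<Sum>b<n. D $$ (i, b) * P $$ (k, b)) = 0) \<and>
     (\<forall>j<n. \<forall>l<n. (\<Sum>a<m. D $$ (a, j) * P $$ (a, l)) = 0)"

lemma mat_perp_two_sided_normal:
  assumes P: "P \<in> carrier_mat m n" "vec_space.rank m P \<le> r"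
    and D: "D \<in> mat_perp m n (tangent_space m n (determinantal_variety m n r) P)"
  shows "two_sided_normal m n P D"
  unfolding two_sided_normal_def
proof (intro conjI allI impI)
  fix i k assume ik: "i < m" "k < m"
  have "0 = mat_form m n D (mat m n (\<lambda>(a, b). if a = i then P $$ (k, b) else 0))"
    using D tangent_space_row[OF P ik] by (simp add: mat_perp_def)
  also have "\<dots> = (\<Sum>a<m. if a = i then \<Sum>b<n. D $$ (i, b) * P $$ (k, b) else 0)"
    unfolding mat_form_def by (intro sum.cong) auto
  also have "\<dots> = (\<Sum>b<n. D $$ (i, b) * P $$ (k, b))" using ik by simp
  finally show "(\<Sum>b<n. D $$ (i, b) * P $$ (k, b)) = 0" by simp
next
  fix j l assume jl: "j < n" "l < n"
  have "0 = mat_form m n D (mat m n (\<lambda>(a, b). if b = j then P $$ (a, l) else 0))"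
    using D tangent_space_col[OF P jl] by (simp add: mat_perp_def)
  also have "\<dots> = (\<Sum>a<m. \<Sum>b<n. if b = j then D $$ (a, j) * P $$ (a, l) else 0)"
    unfolding mat_form_def by (intro sum.cong) auto
  also have "\<dots> = (\<Sum>a<m. D $$ (a, j) * P $$ (a, l))" using jl by simp
  finally show "(\<Sum>a<m. D $$ (a, j) * P $$ (a, l)) = 0" by simp
qed

lemma det_nonzero_kernel:
  fixes A :: "'a :: field mat"
  assumes "A \<in> carrier_mat r r" "det A \<noteq> 0" "\<And>k. k < r \<Longrightarrow> (\<Sum>l<r. A $$ (k, l) * g l) = 0" "l < r"
  shows "g l = 0"
proof -
  have "A *\<^sub>v vec r g = 0\<^sub>v r"
    using assms(1,3) by (intro eq_vecI) (auto simp: scalar_prod_def lessThan_atLeast0)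
  hence "vec r g = 0\<^sub>v r"
    using det_0_iff_vec_prod_zero_field[OF assms(1)] assms(2) vec_carrier[of r g] by blast
  thus ?thesis using assms(4) by (metis index_vec index_zero_vec(1))
qed

text \<open>The candidates for normal vectors at \<open>block_P P1 L1 R1\<close>: the rows of \<open>block_L L1\<close>
  and the columns of \<open>block_R R1\<close> span its left kernel and its right kernel when \<open>P1\<close> is invertible.\<close>

definition normal_mat :: "complex mat \<Rightarrow> complex mat \<Rightarrow> complex mat \<Rightarrow> complex mat" where
  "normal_mat L1 R1 \<Lambda> = (block_R R1 * \<Lambda> * block_L L1)\<^sup>T"

lemma normal_mat_carrier:
  assumes "L1 \<in> carrier_mat (m - r) r" "R1 \<in> carrier_mat r (n - r)" "\<Lambda> \<in> carrier_mat (n - r) (m - r)"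
    "r \<le> m" "r \<le> n"
  shows "normal_mat L1 R1 \<Lambda> \<in> carrier_mat m n"
  using block_L_carrier[OF assms(1,4)] block_R_carrier[OF assms(2,5)] assms(3)
  by (auto simp: normal_mat_def)

text \<open>Cancelling the invertible \<open>P1\<close> in the two normality equations expresses the first \<open>r\<close> columns
  of \<open>D\<close> by the others through \<open>R1\<close>, and the first \<open>r\<close> rows through \<open>L1\<close>. So \<open>D\<close> is
  determined by its lower right block, whose transpose is \<open>\<Lambda>\<close>; the signs in the two identity
  blocks cancel.\<close>

lemma two_sided_normal_block:
  assumes P1: "P1 \<in> carrier_mat r r" and L1: "L1 \<in> carrier_mat (m - r) r" and R1: "R1 \<in> carrier_mat r (n - r)"
    and r: "r \<le> m" "r \<le> n" and det: "det P1 \<noteq> 0"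
    and D: "D \<in> carrier_mat m n" "two_sided_normal m n (block_P P1 L1 R1) D"
  shows "\<exists>\<Lambda>\<in>carrier_mat (n - r) (m - r). D = normal_mat L1 R1 \<Lambda>"
proof -
  note entry = block_P_entry[OF P1 L1 R1 r]
  have cols: "D $$ (i, l) + (\<Sum>b<n - r. R1 $$ (l, b) * D $$ (i, b + r)) = 0" if "i < m" "l < r" for i l
  proof (rule det_nonzero_kernel[OF P1 det _ that(2)])
    fix k assume k: "k < r"
    have "0 = (\<Sum>b<n. D $$ (i, b) * block_P P1 L1 R1 $$ (k, b))"
      using D(2) that k r unfolding two_sided_normal_def by simp
    also have "\<dots> = (\<Sum>l<r. D $$ (i, l) * P1 $$ (k, l)) +
        (\<Sum>b<n - r. D $$ (i, b + r) * (\<Sum>l<r. P1 $$ (k, l) * R1 $$ (l, b)))"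
      unfolding sum_lessThan_split[OF r(2)] using k r
      by (intro arg_cong2[of _ _ _ _ "(+)"] sum.cong) (auto simp: entry)
    also have "\<dots> = (\<Sum>l<r. P1 $$ (k, l) * D $$ (i, l)) +
        (\<Sum>l<r. \<Sum>b<n - r. P1 $$ (k, l) * (R1 $$ (l, b) * D $$ (i, b + r)))"
      unfolding sum_distrib_left by (subst sum.swap) (simp add: mult_ac)
    also have "\<dots> = (\<Sum>l<r. P1 $$ (k, l) * (D $$ (i, l) + (\<Sum>b<n - r. R1 $$ (l, b) * D $$ (i, b + r))))"
      by (simp add: distrib_left sum.distrib sum_distrib_left)
    finally show "(\<Sum>l<r. P1 $$ (k, l) * (D $$ (i, l) + (\<Sum>b<n - r. R1 $$ (l, b) * D $$ (i, b + r)))) = 0" by simp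
  qed
  have rows: "D $$ (k, j) + (\<Sum>a<m - r. D $$ (a + r, j) * L1 $$ (a, k)) = 0" if "k < r" "j < n" for k j
  proof (rule det_nonzero_kernel[of "P1\<^sup>T" r _ k])
    show "P1\<^sup>T \<in> carrier_mat r r" "det P1\<^sup>T \<noteq> 0" using P1 det by (auto simp: det_transpose)
    show "k < r" by fact
    fix l assume l: "l < r"
    have "0 = (\<Sum>a<m. D $$ (a, j) * block_P P1 L1 R1 $$ (a, l))"
      using D(2) that l r unfolding two_sided_normal_def by simp
    also have "\<dots> = (\<Sum>k<r. D $$ (k, j) * P1 $$ (k, l)) +
        (\<Sum>a<m - r. D $$ (a + r, j) * (\<Sum>k<r. L1 $$ (a, k) * P1 $$ (k, l)))"
      unfolding sum_lessThan_split[OF r(1)] using l r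
      by (intro arg_cong2[of _ _ _ _ "(+)"] sum.cong) (auto simp: entry)
    also have "\<dots> = (\<Sum>k<r. P1 $$ (k, l) * D $$ (k, j)) +
        (\<Sum>k<r. \<Sum>a<m - r. P1 $$ (k, l) * (D $$ (a + r, j) * L1 $$ (a, k)))"
      unfolding sum_distrib_left by (subst sum.swap) (simp add: mult_ac)
    also have "\<dots> = (\<Sum>k<r. P1 $$ (k, l) * (D $$ (k, j) + (\<Sum>a<m - r. D $$ (a + r, j) * L1 $$ (a, k))))"
      by (simp add: distrib_left sum.distrib sum_distrib_left)
    also have "\<dots> = (\<Sum>k<r. P1\<^sup>T $$ (l, k) * (D $$ (k, j) + (\<Sum>a<m - r. D $$ (a + r, j) * L1 $$ (a, k))))"
      using P1 l by (intro sum.cong) auto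
    finally show "(\<Sum>k<r. P1\<^sup>T $$ (l, k) * (D $$ (k, j) + (\<Sum>a<m - r. D $$ (a + r, j) * L1 $$ (a, k)))) = 0"
      by simp
  qed
  define \<Lambda> where "\<Lambda> = mat (n - r) (m - r) (\<lambda>(b, a). D $$ (a + r, b + r))"
  have \<Lambda>: "\<Lambda> \<in> carrier_mat (n - r) (m - r)" by (simp add: \<Lambda>_def)
  have \<Lambda>L: "\<Lambda> * block_L L1 \<in> carrier_mat (n - r) m" using \<Lambda> block_L_carrier[OF L1 r(1)] by simp
  have \<Lambda>L_entry: "(\<Lambda> * block_L L1) $$ (b, i) = - D $$ (i, b + r)" if "b < n - r" "i < m" for b i
  proof (cases "i < r")
    case True
    have "(\<Lambda> * block_L L1) $$ (b, i) = (\<Sum>a<m - r. D $$ (a + r, b + r) * L1 $$ (a, i))"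
      unfolding mult_block_L[OF L1 r(1) \<Lambda> that] using True that by (simp add: \<Lambda>_def)
    thus ?thesis using rows[OF True, of "b + r"] that by (simp add: eq_neg_iff_add_eq_0 add.commute)
  next
    case False
    thus ?thesis unfolding mult_block_L[OF L1 r(1) \<Lambda> that] using that by (simp add: \<Lambda>_def)
  qed
  have "D = (block_R R1 * (\<Lambda> * block_L L1))\<^sup>T"
  proof (rule eq_matI)
    fix i j assume "i < dim_row (block_R R1 * (\<Lambda> * block_L L1))\<^sup>T" "j < dim_col (block_R R1 * (\<Lambda> * block_L L1))\<^sup>T"
    hence ij: "i < m" "j < n" using \<Lambda>L block_R_carrier[OF R1 r(2)] by auto
    have "(block_R R1 * (\<Lambda> * block_L L1)) $$ (j, i) = D $$ (i, j)"
    proof (cases "j < r")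
      case True
      have "(block_R R1 * (\<Lambda> * block_L L1)) $$ (j, i) = - (\<Sum>b<n - r. R1 $$ (j, b) * D $$ (i, b + r))"
        unfolding block_R_mult[OF R1 r(2) \<Lambda>L ij(2,1)] using True ij
        by (simp add: \<Lambda>L_entry sum_negf del: index_mult_mat(1))
      thus ?thesis using cols[OF ij(1) True] by (simp add: neg_eq_iff_add_eq_0 add.commute)
    next
      case False
      thus ?thesis unfolding block_R_mult[OF R1 r(2) \<Lambda>L ij(2,1)] using ij
        by (simp add: \<Lambda>L_entry del: index_mult_mat(1))
    qed
    thus "D $$ (i, j) = (block_R R1 * (\<Lambda> * block_L L1))\<^sup>T $$ (i, j)"
      using ij \<Lambda>L block_R_carrier[OF R1 r(2)]
      by (subst index_transpose_mat(1)) (auto simp del: index_mult_mat(1))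
  qed (use D(1) \<Lambda>L block_R_carrier[OF R1 r(2)] in auto)
  thus ?thesis using \<Lambda> assoc_mult_mat[OF block_R_carrier[OF R1 r(2)] \<Lambda> block_L_carrier[OF L1 r(1)]]
    unfolding normal_mat_def by (intro bexI[OF _ \<Lambda>]) simp
qed

lemma poly_mapI:
  assumes "\<And>X. F X \<in> carrier_mat p q"
    and "\<And>i j. i < p \<Longrightarrow> j < q \<Longrightarrow> (\<lambda>X. F X $$ (i, j)) \<in> poly_funs m n"
  shows "poly_map m n p q F"
  using assms by (simp add: poly_map_def)

lemma poly_map_entry: "poly_map m n p q F \<Longrightarrow> i < p \<Longrightarrow> j < q \<Longrightarrow> (\<lambda>X. F X $$ (i, j)) \<in> poly_funs m n"
  by (simp add: poly_map_def)

lemma poly_map_carrier: "poly_map m n p q F \<Longrightarrow> F X \<in> carrier_mat p q"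
  by (simp add: poly_map_def)

lemma poly_map_const: "A \<in> carrier_mat p q \<Longrightarrow> poly_map m n p q (\<lambda>_. A)"
  by (intro poly_mapI poly_funs.const)

lemma poly_map_entrywise:
  "poly_map m n p q (\<lambda>X. mat p q (f X)) \<longleftrightarrow> (\<forall>i<p. \<forall>j<q. (\<lambda>X. f X (i, j)) \<in> poly_funs m n)"
  by (simp add: poly_map_def)

lemma poly_map_mult:
  assumes F: "poly_map m n p q F" and G: "poly_map m n q s G"
  shows "poly_map m n p s (\<lambda>X. F X * G X)"
proof (rule poly_mapI)
  show "F X * G X \<in> carrier_mat p s" for X
    using poly_map_carrier[OF F] poly_map_carrier[OF G] by (rule mult_carrier_mat)
  show "(\<lambda>X. (F X * G X) $$ (i, j)) \<in> poly_funs m n" if "i < p" "j < s" for i j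
    unfolding mult_entry[OF poly_map_carrier[OF F] poly_map_carrier[OF G] that]
    by (intro poly_funs_sum poly_funs.mult poly_map_entry[OF F] poly_map_entry[OF G]) (use that in auto)
qed

lemma poly_funs_det:
  assumes F: "poly_map m n p p F"
  shows "(\<lambda>X. det (F X)) \<in> poly_funs m n"
  unfolding det_def'[OF poly_map_carrier[OF F]]
  by (intro poly_funs_sum poly_funs.mult poly_funs.const poly_funs_prod poly_map_entry[OF F])
     (auto simp: finite_permutations dest: permutes_in_image)

lemma poly_funs_minor:
  assumes F: "poly_map m n p q F" and "\<And>i. i < k \<Longrightarrow> a i < p" "\<And>i. i < k \<Longrightarrow> b i < q"
  shows "(\<lambda>X. minor (F X) k a b) \<in> poly_funs m n"
  unfolding minor_def
  by (rule poly_funs_det[where p = k]) (use assms in \<open>auto simp: poly_map_entrywise intro: poly_map_entry[OF F]\<close>)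

lemma isCont_det:
  assumes "\<And>t. N t \<in> carrier_mat p p" "\<And>i j. i < p \<Longrightarrow> j < p \<Longrightarrow> isCont (\<lambda>t. N t $$ (i, j)) t0"
  shows "isCont (\<lambda>t :: complex. det (N t) :: complex) t0"
proof -
  have "p i < q" if "p permutes {0..<q}" "i < q" for p :: "nat \<Rightarrow> nat" and i q
    using permutes_in_image[OF that(1), of i] that(2) by simp
  thus ?thesis
    unfolding det_def'[OF assms(1)] isCont_def
    using assms(2)[unfolded isCont_def]
    by (intro tendsto_sum tendsto_mult tendsto_const tendsto_prod) auto
qed

text \<open>The difference quotient of \<open>t * g t\<close> at \<open>0\<close> is \<open>g t\<close> itself, so continuity of \<open>g\<close> suffices.
  This spares differentiating a determinant.\<close>

lemma scaled_function_has_derivative_value: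
  fixes g :: "complex \<Rightarrow> complex"
  assumes "isCont g 0"
  shows "((\<lambda>t. t * g t) has_field_derivative g 0) (at 0)"
proof -
  have "\<forall>\<^sub>F t in at 0. g t = (t * g t - 0 * g 0) / (t - 0)"
    by (auto simp: eventually_at_filter)
  from tendsto_cong[OF this] show ?thesis
    using assms unfolding has_field_derivative_iff isCont_def by simp
qed

lemma det_scale_column:
  fixes A B :: "'a :: comm_ring_1 mat"
  assumes "A \<in> carrier_mat p p" "B \<in> carrier_mat p p" "k < p"
    and "\<And>i j. i < p \<Longrightarrow> j < p \<Longrightarrow> A $$ (i, j) = (if j = k then t * B $$ (i, j) else B $$ (i, j))"
  shows "det A = t * det B"
proof -
  have "A\<^sup>T = multrow k t (B\<^sup>T)"
    using assms by (intro eq_matI) auto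
  hence "det (A\<^sup>T) = t * det (B\<^sup>T)"
    using det_multrow[OF assms(3), of "B\<^sup>T" t] assms(2) by simp
  thus ?thesis using assms(1,2) by (simp add: det_transpose)
qed

text \<open>Fix an entry \<open>(i, j)\<close> of \<open>L X R\<close>. The polynomial \<open>f A = det (S A T)\<close>, where \<open>S\<close> selects the
  first \<open>r\<close> rows and appends row \<open>i\<close> of \<open>L\<close>, and \<open>T\<close> does the same for columns with
  column \<open>j\<close> of \<open>R\<close>, vanishes on the variety. Since \<open>L P = 0\<close> and \<open>P R = 0\<close>, at \<open>A = P\<close>
  only the block \<open>P1\<close> survives, and the derivative of \<open>f\<close> in direction \<open>X\<close> is \<open>det P1\<close>
  times the entry in question.\<close>

lemma tangent_space_annihilated:
  assumes P1: "P1 \<in> carrier_mat r r" and L1: "L1 \<in> carrier_mat (m - r) r" and R1: "R1 \<in> carrier_mat r (n - r)"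
    and r: "r \<le> m" "r \<le> n" and det: "det P1 \<noteq> 0"
    and X: "X \<in> tangent_space m n (determinantal_variety m n r) (block_P P1 L1 R1)"
  shows "block_L L1 * X * block_R R1 = 0\<^sub>m (m - r) (n - r)"
proof (rule eq_matI)
  note Lc = block_L_carrier[OF L1 r(1)] and Rc = block_R_carrier[OF R1 r(2)]
  define P where "P = block_P P1 L1 R1"
  have P: "P \<in> carrier_mat m n" unfolding P_def by (rule block_P_carrier[OF P1 L1 R1 r])
  have Xc: "X \<in> carrier_mat m n" using X by (simp add: tangent_space_def)
  have LX: "block_L L1 * X \<in> carrier_mat (m - r) n" using Lc Xc by simp
  show "dim_row (block_L L1 * X * block_R R1) = dim_row (0\<^sub>m (m - r) (n - r))"
    "dim_col (block_L L1 * X * block_R R1) = dim_col (0\<^sub>m (m - r) (n - r))" using LX Lc Rc by auto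
  fix i j assume "i < dim_row (0\<^sub>m (m - r) (n - r))" "j < dim_col (0\<^sub>m (m - r) (n - r))"
  hence ij: "i < m - r" "j < n - r" by auto
  define S where "S = mat (Suc r) m (\<lambda>(a, k). if a < r then if k = a then 1 else 0 else block_L L1 $$ (i, k))"
  define T where "T = mat n (Suc r) (\<lambda>(l, b). if b < r then if l = b then 1 else 0 else block_R R1 $$ (l, j))"
  have S: "S \<in> carrier_mat (Suc r) m" and T: "T \<in> carrier_mat n (Suc r)" by (auto simp: S_def T_def)
  define f where "f A = det (S * mat m n (($$) A) * T)" for A
  have f_poly: "f \<in> poly_funs m n"
  proof -
    have "poly_map m n m n (\<lambda>A. mat m n (($$) A))"
      by (auto simp: poly_map_entrywise intro: poly_funs.entry)
    from poly_map_mult[OF poly_map_mult[OF poly_map_const[OF S] this] poly_map_const[OF T]]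
    show ?thesis unfolding f_def[abs_def] by (rule poly_funs_det)
  qed
  have mat_id: "mat m n (($$) A) = A" if "A \<in> carrier_mat m n" for A :: "complex mat"
    using that by (intro eq_matI) auto
  have f_vanishes: "f A = 0" if "A \<in> determinantal_variety m n r" for A
  proof -
    have A: "A \<in> carrier_mat m n" "vec_space.rank m A \<le> r"
      using that by (auto simp: determinantal_variety_def)
    obtain B C where BC: "B \<in> carrier_mat m (vec_space.rank m A)" "C \<in> carrier_mat (vec_space.rank m A) n" "A = B * C"
      using vec_space.rank_factorization[OF A(1)] by blast
    have "S * A * T = (S * B) * (C * T)"
    proof -
      have "S * A * T = S * B * C * T" using BC S by (metis assoc_mult_mat)
      also have "\<dots> = (S * B) * (C * T)"
        by (rule assoc_mult_mat[OF mult_carrier_mat[OF S BC(1)] BC(2) T])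
      finally show ?thesis .
    qed
    thus ?thesis
      unfolding f_def mat_id[OF A(1)]
      using det_mult_narrow[OF mult_carrier_mat[OF S BC(1)] mult_carrier_mat[OF BC(2) T]] A(2) by simp
  qed
  have bilinear: "(S * A * T) $$ (a, b) = (if a < r then
        if b < r then A $$ (a, b) else (A * block_R R1) $$ (a, j)
      else if b < r then (block_L L1 * A) $$ (i, b) else (block_L L1 * A * block_R R1) $$ (i, j))"
    if A: "A \<in> carrier_mat m n" and ab: "a < Suc r" "b < Suc r" for A a b
  proof -
    have SA: "(S * A) $$ (a, l) = (if a < r then A $$ (a, l) else (block_L L1 * A) $$ (i, l))" if l: "l < n" for l
    proof (cases "a < r")
      case True
      have "(S * A) $$ (a, l) = (\<Sum>k<m. if k = a then A $$ (k, l) else 0)"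
        unfolding mult_entry[OF S A ab(1) l] using True ab by (intro sum.cong) (auto simp: S_def)
      thus ?thesis using True r by simp
    next
      case False
      thus ?thesis unfolding mult_entry[OF S A ab(1) l] mult_entry[OF Lc A ij(1) l]
        using ab by (auto simp: S_def)
    qed
    have SAc: "S * A \<in> carrier_mat (Suc r) n" and LAc: "block_L L1 * A \<in> carrier_mat (m - r) n"
      using S Lc A by auto
    show ?thesis
    proof (cases "b < r")
      case True
      have "(S * A * T) $$ (a, b) = (\<Sum>l<n. if l = b then (S * A) $$ (a, l) else 0)"
        unfolding mult_entry[OF SAc T ab] using True ab by (intro sum.cong) (auto simp: T_def)
      thus ?thesis using True r SA[of b] by simp
    next
      case False
      have "(S * A * T) $$ (a, b) = (\<Sum>l<n. (S * A) $$ (a, l) * block_R R1 $$ (l, j))"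
        unfolding mult_entry[OF SAc T ab] using False ab by (intro sum.cong) (auto simp: T_def)
      also have "\<dots> = (if a < r then (A * block_R R1) $$ (a, j) else (block_L L1 * A * block_R R1) $$ (i, j))"
      proof (cases "a < r")
        case True
        thus ?thesis using r mult_entry[OF A Rc _ ij(2), of a] by (simp add: SA del: index_mult_mat(1))
      next
        case False
        thus ?thesis by (simp add: SA mult_entry[OF LAc Rc ij] del: index_mult_mat(1))
      qed
      finally show ?thesis using False by simp
    qed
  qed
  define SP where "SP = S * P * T"
  define SX where "SX = S * X * T"
  have SP: "SP \<in> carrier_mat (Suc r) (Suc r)" and SX: "SX \<in> carrier_mat (Suc r) (Suc r)"
    using S T P Xc by (auto simp: SP_def SX_def)
  have SP_entry: "SP $$ (a, b) = (if a < r \<and> b < r then P1 $$ (a, b) else 0)" if ab: "a < Suc r" "b < Suc r" for a b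
  proof -
    have "block_L L1 * P = 0\<^sub>m (m - r) n" "P * block_R R1 = 0\<^sub>m m (n - r)"
      unfolding P_def using block_L_mult_block_P[OF P1 L1 R1 r] block_P_mult_block_R[OF P1 L1 R1 r] by auto
    moreover have "P $$ (a, b) = P1 $$ (a, b)" if "a < r" "b < r"
      using that r unfolding P_def by (simp add: block_P_entry[OF P1 L1 R1 r])
    ultimately show ?thesis
      unfolding SP_def bilinear[OF P ab] using ij r Rc by (auto simp: left_mult_zero_mat simp del: index_mult_mat(1))
  qed
  \<comment> \<open>The last column of \<open>S * P * T\<close> is zero, so that of \<open>S * (P + t X) * T\<close> is divisible by \<open>t\<close>;
    \<open>N t\<close> is the quotient.\<close>
  define N where "N t = mat (Suc r) (Suc r) (\<lambda>(a, b). if b < r then SP $$ (a, b) + t * SX $$ (a, b) else SX $$ (a, b))" for t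
  have N: "N t \<in> carrier_mat (Suc r) (Suc r)" for t by (simp add: N_def)
  have "f (P + t \<cdot>\<^sub>m X) = t * det (N t)" for t
  proof -
    have PX: "P + t \<cdot>\<^sub>m X \<in> carrier_mat m n" using P Xc by simp
    have "S * (P + t \<cdot>\<^sub>m X) * T = SP + t \<cdot>\<^sub>m SX"
    proof -
      have "S * (P + t \<cdot>\<^sub>m X) = S * P + t \<cdot>\<^sub>m (S * X)"
        using S P Xc by (simp add: mult_add_distrib_mat mult_smult_distrib)
      thus ?thesis unfolding SP_def SX_def using S P Xc T
        by (simp add: add_mult_distrib_mat[of _ "Suc r" n] mult_smult_assoc_mat[of _ "Suc r" n])
    qed
    hence "f (P + t \<cdot>\<^sub>m X) = det (SP + t \<cdot>\<^sub>m SX)" unfolding f_def mat_id[OF PX] by simp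
    also have "\<dots> = t * det (N t)"
      by (rule det_scale_column[OF _ N, of _ r]) (use SP SX in \<open>auto simp: N_def SP_entry\<close>)
    finally show ?thesis .
  qed
  moreover have "((\<lambda>t. f (P + t \<cdot>\<^sub>m X)) has_field_derivative 0) (at 0)"
    using X f_poly f_vanishes unfolding tangent_space_def P_def by blast
  moreover have "isCont (\<lambda>t. det (N t)) 0"
  proof (rule isCont_det[OF N])
    fix a b assume "a < Suc r" "b < Suc r"
    thus "isCont (\<lambda>t. N t $$ (a, b)) 0" unfolding N_def by (cases "b < r") auto
  qed
  ultimately have N0: "det (N 0) = 0"
    using DERIV_unique[OF scaled_function_has_derivative_value] by force
  have "N 0 = four_block_mat P1 (mat r 1 (\<lambda>(a, b). SX $$ (a, r))) (0\<^sub>m 1 r) (mat 1 1 (\<lambda>_. SX $$ (r, r)))"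
    using P1 by (intro eq_matI) (auto simp: N_def SP_entry less_Suc_eq)
  hence "det (N 0) = det P1 * SX $$ (r, r)"
    using det_four_block_mat_lower_left_zero[OF P1, of "mat r 1 (\<lambda>(a, b). SX $$ (a, r))" 1 "0\<^sub>m 1 r"
        "mat 1 1 (\<lambda>_. SX $$ (r, r))"] det_single[of "mat 1 1 (\<lambda>_. SX $$ (r, r))"] by simp
  hence "SX $$ (r, r) = 0" using N0 det by simp
  thus "(block_L L1 * X * block_R R1) $$ (i, j) = 0\<^sub>m (m - r) (n - r) $$ (i, j)"
    unfolding SX_def bilinear[OF Xc, of r r, OF lessI lessI] using ij by simp
qed

section \<open>The system as the fibre of a polynomial self-map\<close>

lemma sum_mat_eq:
  assumes "A \<in> carrier_mat m n"
  shows "sum_mat A = (\<Sum>i<m. \<Sum>j<n. A $$ (i, j))"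
  using assms by (simp add: sum_mat_def sum.cartesian_product lessThan_atLeast0)

text \<open>By cyclicity of the trace the form is the trace of \<open>\<Lambda> (L X R)\<close>.\<close>

lemma normal_mat_form:
  assumes L1: "L1 \<in> carrier_mat (m - r) r" and R1: "R1 \<in> carrier_mat r (n - r)"
    and \<Lambda>: "\<Lambda> \<in> carrier_mat (n - r) (m - r)" and r: "r \<le> m" "r \<le> n" and X: "X \<in> carrier_mat m n"
    and LXR: "block_L L1 * X * block_R R1 = 0\<^sub>m (m - r) (n - r)"
  shows "mat_form m n (normal_mat L1 R1 \<Lambda>) X = 0"
proof -
  note Lc = block_L_carrier[OF L1 r(1)] and Rc = block_R_carrier[OF R1 r(2)]
  have \<Lambda>L: "\<Lambda> * block_L L1 \<in> carrier_mat (n - r) m" and XR: "X * block_R R1 \<in> carrier_mat m (n - r)"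
    and G: "block_R R1 * \<Lambda> * block_L L1 \<in> carrier_mat n m" using Lc Rc \<Lambda> X by auto
  have "mat_form m n (normal_mat L1 R1 \<Lambda>) X = (\<Sum>i<m. (X * (block_R R1 * \<Lambda> * block_L L1)) $$ (i, i))"
    unfolding mat_form_def
  proof (intro sum.cong refl)
    fix i assume i: "i \<in> {..<m}"
    have "normal_mat L1 R1 \<Lambda> $$ (i, j) = (block_R R1 * \<Lambda> * block_L L1) $$ (j, i)" if "j < n" for j
      unfolding normal_mat_def using G i that by (intro index_transpose_mat(1)) auto
    thus "(\<Sum>j<n. normal_mat L1 R1 \<Lambda> $$ (i, j) * X $$ (i, j)) = (X * (block_R R1 * \<Lambda> * block_L L1)) $$ (i, i)"
      using i by (simp add: mult_entry[OF X G] mult.commute del: index_mult_mat(1))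
  qed
  also have "X * (block_R R1 * \<Lambda> * block_L L1) = (X * block_R R1) * (\<Lambda> * block_L L1)"
    using assoc_mult_mat[OF X Rc \<Lambda>L] assoc_mult_mat[OF Rc \<Lambda> Lc] by simp
  also have "(\<Sum>i<m. (X * block_R R1 * (\<Lambda> * block_L L1)) $$ (i, i)) =
      (\<Sum>i<n - r. (\<Lambda> * block_L L1 * (X * block_R R1)) $$ (i, i))"
    by (rule trace_comm[OF XR \<Lambda>L])
  also have "\<Lambda> * block_L L1 * (X * block_R R1) = \<Lambda> * (block_L L1 * X * block_R R1)"
    using assoc_mult_mat[OF \<Lambda> Lc XR] assoc_mult_mat[OF Lc X Rc] by simp
  also have "\<dots> = 0\<^sub>m (n - r) (n - r)" unfolding LXR using \<Lambda> by simp
  finally show ?thesis by simp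
qed

lemma system_lhs_carrier:
  assumes "x \<in> unknowns m n r" "r \<le> m" "r \<le> n"
  shows "system_lhs U x \<in> carrier_mat m n"
proof -
  obtain P1 L1 R1 \<Lambda> where x: "x = (P1, L1, R1, \<Lambda>)" by (cases x)
  show ?thesis
    using assms block_P_carrier[of P1 r L1 m R1 n] unfolding x unknowns_def system_lhs_def hadamard_def by auto
qed

lemma system_lhs_entry:
  assumes "P1 \<in> carrier_mat r r" "L1 \<in> carrier_mat (m - r) r" "R1 \<in> carrier_mat r (n - r)"
    "\<Lambda> \<in> carrier_mat (n - r) (m - r)" "r \<le> m" "r \<le> n" "i < m" "j < n"
  shows "system_lhs U (P1, L1, R1, \<Lambda>) $$ (i, j) =
    block_P P1 L1 R1 $$ (i, j) * normal_mat L1 R1 \<Lambda> $$ (i, j) + sum_mat U * block_P P1 L1 R1 $$ (i, j)"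
  using block_P_carrier[OF assms(1-3,5,6)] assms(7,8)
  unfolding system_lhs_def hadamard_def normal_mat_def
  by (auto simp del: index_mult_mat(1) index_transpose_mat(1))

definition unpack_P where "unpack_P r X = mat r r (\<lambda>(i, j). X $$ (i, j))"
definition unpack_L where "unpack_L m r X = mat (m - r) r (\<lambda>(i, j). X $$ (i + r, j))"
definition unpack_R where "unpack_R n r X = mat r (n - r) (\<lambda>(i, j). X $$ (i, j + r))"
definition unpack_\<Lambda> where "unpack_\<Lambda> m n r X = mat (n - r) (m - r) (\<lambda>(b, a). X $$ (a + r, b + r))"

text \<open>The matrix \<open>P\<close> of the system as a function of all unknowns, packed into one matrix \<open>X\<close>.\<close>

definition unpack_block :: "nat \<Rightarrow> nat \<Rightarrow> nat \<Rightarrow> complex mat \<Rightarrow> complex mat" where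
  "unpack_block m n r X = block_P (unpack_P r X) (unpack_L m r X) (unpack_R n r X)"

definition pack :: "complex mat \<Rightarrow> complex mat \<Rightarrow> complex mat \<Rightarrow> complex mat \<Rightarrow> complex mat" where
  "pack P1 L1 R1 \<Lambda> = four_block_mat P1 R1 L1 \<Lambda>\<^sup>T"

text \<open>The map \<open>\<Psi>\<close> of the introduction: \<open>P \<star> ((R \<Lambda> L)\<^sup>T + J)\<close> as a function of the packed
  unknowns.\<close>

definition rescaled_system :: "nat \<Rightarrow> nat \<Rightarrow> nat \<Rightarrow> complex mat \<Rightarrow> complex mat" where
  "rescaled_system m n r X = mat m n (\<lambda>p. unpack_block m n r X $$ p *
     (normal_mat (unpack_L m r X) (unpack_R n r X) (unpack_\<Lambda> m n r X) $$ p + 1))"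

lemma pack_carrier:
  assumes "P1 \<in> carrier_mat r r" "\<Lambda> \<in> carrier_mat (n - r) (m - r)" "r \<le> m" "r \<le> n"
  shows "pack P1 L1 R1 \<Lambda> \<in> carrier_mat m n"
  using assms by (auto simp: pack_def)

lemma unpack_pack:
  assumes "P1 \<in> carrier_mat r r" "L1 \<in> carrier_mat (m - r) r" "R1 \<in> carrier_mat r (n - r)"
    "\<Lambda> \<in> carrier_mat (n - r) (m - r)" "r \<le> m" "r \<le> n"
  shows "unpack_P r (pack P1 L1 R1 \<Lambda>) = P1" "unpack_L m r (pack P1 L1 R1 \<Lambda>) = L1"
    "unpack_R n r (pack P1 L1 R1 \<Lambda>) = R1" "unpack_\<Lambda> m n r (pack P1 L1 R1 \<Lambda>) = \<Lambda>"
  unfolding unpack_P_def unpack_L_def unpack_R_def unpack_\<Lambda>_def pack_def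
  using assms by (auto intro!: eq_matI)

lemma block_P_smult:
  assumes "P1 \<in> carrier_mat r r" "L1 \<in> carrier_mat (m - r) r" "R1 \<in> carrier_mat r (n - r)" "r \<le> m" "r \<le> n"
  shows "block_P (s \<cdot>\<^sub>m P1) L1 R1 = s \<cdot>\<^sub>m block_P P1 L1 R1"
proof (rule eq_matI)
  have s: "s \<cdot>\<^sub>m P1 \<in> carrier_mat r r" using assms(1) by simp
  note c = block_P_carrier[OF assms] block_P_carrier[OF s assms(2-)]
  show "dim_row (block_P (s \<cdot>\<^sub>m P1) L1 R1) = dim_row (s \<cdot>\<^sub>m block_P P1 L1 R1)"
    "dim_col (block_P (s \<cdot>\<^sub>m P1) L1 R1) = dim_col (s \<cdot>\<^sub>m block_P P1 L1 R1)" using c by auto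
  fix i j assume "i < dim_row (s \<cdot>\<^sub>m block_P P1 L1 R1)" "j < dim_col (s \<cdot>\<^sub>m block_P P1 L1 R1)"
  hence ij: "i < m" "j < n" using c by auto
  show "block_P (s \<cdot>\<^sub>m P1) L1 R1 $$ (i, j) = (s \<cdot>\<^sub>m block_P P1 L1 R1) $$ (i, j)"
    using ij c(1) assms
    by (auto simp: block_P_entry[OF assms ij] block_P_entry[OF s assms(2-) ij] sum_distrib_left
        sum_distrib_right mult_ac intro!: sum.cong)
qed

text \<open>The scaling \<open>P1 \<mapsto> s P1\<close>, \<open>\<Lambda> \<mapsto> \<Lambda> / s\<close> leaves \<open>P \<star> (R \<Lambda> L)\<^sup>T\<close> fixed and turns the
  all-ones summand into \<open>s P\<close>.\<close>

lemma rescaled_system_pack: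
  assumes P1: "P1 \<in> carrier_mat r r" and L1: "L1 \<in> carrier_mat (m - r) r" and R1: "R1 \<in> carrier_mat r (n - r)"
    and \<Lambda>: "\<Lambda> \<in> carrier_mat (n - r) (m - r)" and r: "r \<le> m" "r \<le> n" and s: "s \<noteq> 0"
  shows "rescaled_system m n r (pack (s \<cdot>\<^sub>m P1) L1 R1 ((1 / s) \<cdot>\<^sub>m \<Lambda>)) =
    mat m n (\<lambda>p. block_P P1 L1 R1 $$ p * normal_mat L1 R1 \<Lambda> $$ p + s * block_P P1 L1 R1 $$ p)"
proof -
  have c: "s \<cdot>\<^sub>m P1 \<in> carrier_mat r r" "(1 / s) \<cdot>\<^sub>m \<Lambda> \<in> carrier_mat (n - r) (m - r)" using P1 \<Lambda> by auto
  have "normal_mat L1 R1 ((1 / s) \<cdot>\<^sub>m \<Lambda>) = (1 / s) \<cdot>\<^sub>m normal_mat L1 R1 \<Lambda>"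
    unfolding normal_mat_def mult_smult_distrib[OF block_R_carrier[OF R1 r(2)] \<Lambda>]
      mult_smult_assoc_mat[OF mult_carrier_mat[OF block_R_carrier[OF R1 r(2)] \<Lambda>] block_L_carrier[OF L1 r(1)]]
    by (rule eq_matI) auto
  hence n: "normal_mat L1 R1 ((1 / s) \<cdot>\<^sub>m \<Lambda>) $$ (i, j) = normal_mat L1 R1 \<Lambda> $$ (i, j) / s" if "i < m" "j < n" for i j
    using normal_mat_carrier[OF L1 R1 \<Lambda> r] that by simp
  show ?thesis
    unfolding rescaled_system_def unpack_block_def unpack_pack[OF c(1) L1 R1 c(2) r] block_P_smult[OF P1 L1 R1 r]
    by (intro eq_matI) (use s block_P_carrier[OF P1 L1 R1 r] in \<open>auto simp: n field_simps\<close>)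
qed

lemma poly_map_unpack_block:
  assumes r: "r \<le> m" "r \<le> n"
  shows "poly_map m n m n (unpack_block m n r)"
proof (rule poly_mapI)
  have c: "unpack_P r X \<in> carrier_mat r r" "unpack_L m r X \<in> carrier_mat (m - r) r"
    "unpack_R n r X \<in> carrier_mat r (n - r)" for X
    by (auto simp: unpack_P_def unpack_L_def unpack_R_def)
  show "unpack_block m n r X \<in> carrier_mat m n" for X
    unfolding unpack_block_def by (rule block_P_carrier[OF c r])
  show "(\<lambda>X. unpack_block m n r X $$ (i, j)) \<in> poly_funs m n" if ij: "i < m" "j < n" for i j
    unfolding unpack_block_def block_P_entry[OF c r ij]
    using ij r by (cases "i < r"; cases "j < r")
      (auto simp: unpack_P_def unpack_L_def unpack_R_def intro!: poly_funs_sum poly_funs.mult poly_funs.entry)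
qed

lemma poly_map_rescaled_system:
  assumes r: "r \<le> m" "r \<le> n"
  shows "poly_map m n m n (rescaled_system m n r)"
proof -
  have c: "unpack_L m r X \<in> carrier_mat (m - r) r" "unpack_R n r X \<in> carrier_mat r (n - r)"
    "unpack_\<Lambda> m n r X \<in> carrier_mat (n - r) (m - r)" for X
    by (auto simp: unpack_L_def unpack_R_def unpack_\<Lambda>_def)
  have L: "poly_map m n (m - r) m (\<lambda>X. block_L (unpack_L m r X))"
  proof (rule poly_mapI)
    show "(\<lambda>X. block_L (unpack_L m r X) $$ (i, j)) \<in> poly_funs m n" if ij: "i < m - r" "j < m" for i j
      unfolding block_L_entry[OF c(1) ij] using ij r
      by (cases "j < r") (auto simp: unpack_L_def intro!: poly_funs.const poly_funs.entry)
  qed (rule block_L_carrier[OF c(1) r(1)])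
  have R: "poly_map m n n (n - r) (\<lambda>X. block_R (unpack_R n r X))"
  proof (rule poly_mapI)
    show "(\<lambda>X. block_R (unpack_R n r X) $$ (i, j)) \<in> poly_funs m n" if ij: "i < n" "j < n - r" for i j
      unfolding block_R_entry[OF c(2) ij] using ij r
      by (cases "i < r") (auto simp: unpack_R_def intro!: poly_funs.const poly_funs.entry)
  qed (rule block_R_carrier[OF c(2) r(2)])
  have \<Lambda>: "poly_map m n (n - r) (m - r) (unpack_\<Lambda> m n r)"
    by (rule poly_mapI[OF c(3)]) (use r in \<open>auto simp: unpack_\<Lambda>_def intro!: poly_funs.entry\<close>)
  note RL = poly_map_mult[OF poly_map_mult[OF R \<Lambda>] L]
  have "(\<lambda>X. normal_mat (unpack_L m r X) (unpack_R n r X) (unpack_\<Lambda> m n r X) $$ (i, j)) \<in> poly_funs m n"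
    if ij: "i < m" "j < n" for i j
  proof -
    have "normal_mat (unpack_L m r X) (unpack_R n r X) (unpack_\<Lambda> m n r X) $$ (i, j) =
        (block_R (unpack_R n r X) * unpack_\<Lambda> m n r X * block_L (unpack_L m r X)) $$ (j, i)" for X
      unfolding normal_mat_def using poly_map_carrier[OF RL, of X] ij by (intro index_transpose_mat(1)) auto
    thus ?thesis using poly_map_entry[OF RL ij(2,1)] by simp
  qed
  thus ?thesis
    unfolding rescaled_system_def[abs_def] poly_map_entrywise
    by (auto intro!: poly_funs.mult poly_funs.add poly_funs.const poly_map_entry[OF poly_map_unpack_block[OF r]])
qed

lemma poly_map_permute_mat:
  assumes F: "poly_map m n p q F" and "\<sigma> permutes {..<p}" "\<tau> permutes {..<q}"
  shows "poly_map m n p q (\<lambda>X. permute_mat \<sigma> \<tau> (F X))"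
proof (rule poly_mapI)
  note Fc = poly_map_carrier[OF F]
  show "permute_mat \<sigma> \<tau> (F X) \<in> carrier_mat p q" for X by (rule permute_mat_carrier[OF Fc])
  fix i j assume ij: "i < p" "j < q"
  hence "\<sigma> i < p" "\<tau> j < q"
    using permutes_in_image[OF assms(2), of i] permutes_in_image[OF assms(3), of j] by auto
  moreover have "permute_mat \<sigma> \<tau> (F X) $$ (i, j) = F X $$ (\<sigma> i, \<tau> j)" for X
    using ij Fc[of X] by (simp add: permute_mat_def)
  ultimately show "(\<lambda>X. permute_mat \<sigma> \<tau> (F X) $$ (i, j)) \<in> poly_funs m n"
    using poly_map_entry[OF F] by simp
qed

text \<open>Each of the two minors is a nonzero polynomial in the entries of \<open>A\<close>, as a suitable 0/1 matrix
  shows, so they have a common point of nonvanishing.\<close>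

lemma tall_matrix_two_minors:
  assumes \<sigma>: "\<sigma> permutes {..<m}" and r: "r \<le> m"
  shows "\<exists>A\<in>carrier_mat m r. det (mat r r (\<lambda>(i, k). A $$ (i, k))) \<noteq> (0 :: complex) \<and>
    det (mat r r (\<lambda>(i, k). A $$ (\<sigma> i, k))) \<noteq> 0"
proof -
  define f where "f = (\<lambda>\<pi> (A :: complex mat). minor A r \<pi> id)"
  have f: "f \<pi> \<in> poly_funs m r \<and> (\<exists>A\<in>carrier_mat m r. f \<pi> A \<noteq> 0)" if \<pi>: "\<pi> permutes {..<m}" for \<pi>
  proof
    have \<pi>m: "\<pi> i < m" if "i < r" for i using permutes_in_image[OF \<pi>, of i] that r by auto
    have entries: "poly_map m r m r (\<lambda>A. mat m r (($$) A))"
      by (auto simp: poly_map_entrywise intro: poly_funs.entry)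
    have "(\<lambda>A. minor (mat m r (($$) A)) r \<pi> id) \<in> poly_funs m r"
      by (rule poly_funs_minor[OF entries]) (use \<pi>m in auto)
    moreover have "minor (mat m r (($$) A)) r \<pi> id = f \<pi> A" for A
      unfolding f_def minor_def by (intro arg_cong[of _ _ det] cong_mat) (use \<pi>m in auto)
    ultimately show "f \<pi> \<in> poly_funs m r" by simp
    define A where "A = mat m r (\<lambda>(i, k). if i = \<pi> k then 1 else 0 :: complex)"
    have "mat r r (\<lambda>(i, k). A $$ (\<pi> i, id k)) = 1\<^sub>m r"
      by (rule eq_matI) (auto simp: A_def \<pi>m dest: injD[OF permutes_inj[OF \<pi>]])
    hence "f \<pi> A \<noteq> 0" by (simp add: f_def minor_def)
    thus "\<exists>A\<in>carrier_mat m r. f \<pi> A \<noteq> 0" by (intro bexI[of _ A]) (auto simp: A_def)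
  qed
  obtain A where "A \<in> carrier_mat m r" "f id A \<noteq> 0" "f \<sigma> A \<noteq> 0"
    using f[OF permutes_id] f[OF \<sigma>] poly_funs_domain by metis
  thus ?thesis unfolding f_def minor_def by auto
qed

text \<open>The product \<open>A B\<^sup>T\<close> of two tall matrices has rank at most \<open>r\<close>, and its \<open>r\<close>-minors are
  products of minors of \<open>A\<close> and \<open>B\<close>. Choosing both factors with two nonzero minors puts the
  product into the leading chart with a nonzero \<open>(\<sigma>, \<tau>)\<close>-minor.\<close>

lemma chart_minor_nonzero:
  assumes \<sigma>: "\<sigma> permutes {..<m}" and \<tau>: "\<tau> permutes {..<n}" and r: "r \<le> m" "r \<le> n"
  shows "\<exists>X\<in>carrier_mat m n. minor (unpack_block m n r X) r \<sigma> \<tau> \<noteq> 0"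
proof -
  obtain A where A: "A \<in> carrier_mat m r" "det (mat r r (\<lambda>(i, k). A $$ (i, k))) \<noteq> (0 :: complex)"
    "det (mat r r (\<lambda>(i, k). A $$ (\<sigma> i, k))) \<noteq> 0"
    using tall_matrix_two_minors[OF \<sigma> r(1)] by blast
  obtain B where B: "B \<in> carrier_mat n r" "det (mat r r (\<lambda>(i, k). B $$ (i, k))) \<noteq> (0 :: complex)"
    "det (mat r r (\<lambda>(i, k). B $$ (\<tau> i, k))) \<noteq> 0"
    using tall_matrix_two_minors[OF \<tau> r(2)] by blast
  define M where "M = A * B\<^sup>T"
  have M: "M \<in> carrier_mat m n" using A B by (simp add: M_def)
  have minor: "minor M r a b = det (mat r r (\<lambda>(i, k). A $$ (a i, k))) * det (mat r r (\<lambda>(i, k). B $$ (b i, k)))"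
    if ab: "\<And>i. i < r \<Longrightarrow> a i < m" "\<And>i. i < r \<Longrightarrow> b i < n" for a b
  proof -
    have "mat r r (\<lambda>(i, j). M $$ (a i, b j)) =
        mat r r (\<lambda>(i, k). A $$ (a i, k)) * (mat r r (\<lambda>(i, k). B $$ (b i, k)))\<^sup>T"
      unfolding M_def using A(1) B(1) ab by (intro eq_matI) (auto simp: scalar_prod_def intro!: sum.cong)
    thus ?thesis unfolding minor_def
      by (simp add: det_mult[of _ r] det_transpose[of _ r])
  qed
  have lead: "minor M r id id \<noteq> 0" using minor[of id id] A(2) B(2) r by simp
  have perm: "minor M r \<sigma> \<tau> \<noteq> 0"
  proof -
    have "\<sigma> i < m" "\<tau> i < n" if "i < r" for i
      using permutes_in_image[OF \<sigma>, of i] permutes_in_image[OF \<tau>, of i] that r by auto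
    thus ?thesis using minor[of \<sigma> \<tau>] A(3) B(3) by simp
  qed
  have "vec_space.rank m M \<le> r"
    unfolding M_def by (rule vec_space.rank_mult_le_inner_dim[OF A(1)]) (use B in simp)
  then obtain P1 L1 R1 where b: "P1 \<in> carrier_mat r r" "L1 \<in> carrier_mat (m - r) r"
    "R1 \<in> carrier_mat r (n - r)" "M = block_P P1 L1 R1"
    using block_P_if_rank_le[OF M r lead] by blast
  have "unpack_block m n r (pack P1 L1 R1 (0\<^sub>m (n - r) (m - r))) = M"
    unfolding unpack_block_def b(4) unpack_pack[OF b(1-3) zero_carrier_mat r] ..
  thus ?thesis using perm pack_carrier[OF b(1) _ r, of "0\<^sub>m (n - r) (m - r)"]
    by (intro bexI[of _ "pack P1 L1 R1 (0\<^sub>m (n - r) (m - r))"]) auto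
qed

lemma generic_leading_minor:
  assumes \<sigma>: "\<sigma> permutes {..<m}" and \<tau>: "\<tau> permutes {..<n}" and r: "r \<le> m" "r \<le> n"
  shows "for_generic m n (\<lambda>U. \<forall>X\<in>carrier_mat m n.
    permute_mat \<sigma> \<tau> (rescaled_system m n r X) = U \<longrightarrow> minor (unpack_block m n r X) r \<sigma> \<tau> \<noteq> 0)"
proof -
  obtain X where X: "X \<in> carrier_mat m n" "minor (unpack_block m n r X) r \<sigma> \<tau> \<noteq> 0"
    using chart_minor_nonzero[OF assms] by blast
  have h: "(\<lambda>X. minor (unpack_block m n r X) r \<sigma> \<tau>) \<in> poly_funs m n"
  proof (rule poly_funs_minor[OF poly_map_unpack_block[OF r]])
    show "\<sigma> i < m" "\<tau> i < n" if "i < r" for i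
      using permutes_in_image[OF \<sigma>, of i] permutes_in_image[OF \<tau>, of i] that r by auto
  qed
  show ?thesis
    by (rule generic_avoids_image_of_hypersurface[OF
        poly_map_permute_mat[OF poly_map_rescaled_system[OF r] \<sigma> \<tau>] h X])
qed

text \<open>If \<open>\<Psi>(X)\<close> is \<open>U\<close> with permuted rows and columns, then \<open>X\<close> describes, up to scaling, a
  matrix \<open>P\<close> for \<open>U\<close> in the chart of another \<open>r\<close>-minor; the condition says that the leading
  \<open>r\<close>-minor of this \<open>P\<close> is nonzero as well.\<close>

definition avoids_degenerate_charts :: "nat \<Rightarrow> nat \<Rightarrow> nat \<Rightarrow> complex mat \<Rightarrow> bool" where
  "avoids_degenerate_charts m n r U \<longleftrightarrow>
     (\<forall>\<sigma> \<tau>. \<sigma> permutes {..<m} \<longrightarrow> \<tau> permutes {..<n} \<longrightarrow> (\<forall>X\<in>carrier_mat m n.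
        permute_mat \<sigma> \<tau> (rescaled_system m n r X) = U \<longrightarrow> minor (unpack_block m n r X) r \<sigma> \<tau> \<noteq> 0))"

lemma generic_avoids_degenerate_charts:
  assumes r: "r \<le> m" "r \<le> n"
  shows "for_generic m n (avoids_degenerate_charts m n r)"
proof -
  have "for_generic m n (\<lambda>U. \<forall>p\<in>{\<sigma>. \<sigma> permutes {..<m}} \<times> {\<tau>. \<tau> permutes {..<n}}. \<forall>X\<in>carrier_mat m n.
      permute_mat (fst p) (snd p) (rescaled_system m n r X) = U \<longrightarrow>
      minor (unpack_block m n r X) r (fst p) (snd p) \<noteq> 0)"
    by (rule for_generic_ball) (auto simp: finite_permutations intro: generic_leading_minor[OF _ _ r])
  thus ?thesis
    by (rule for_generic_mono) (auto simp: avoids_degenerate_charts_def)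
qed

lemma generic_nonzero_entries:
  assumes "0 < m" "0 < n"
  shows "for_generic m n (\<lambda>U. (\<forall>i<m. \<forall>j<n. U $$ (i, j) \<noteq> 0) \<and> sum_mat U \<noteq> 0)"
proof (rule for_generic_conj)
  let ?J = "mat m n (\<lambda>_. 1) :: complex mat"
  have "for_generic m n (\<lambda>U. \<forall>p\<in>positions m n. U $$ p \<noteq> 0)"
  proof (rule for_generic_ball)
    fix p assume "p \<in> positions m n"
    then obtain i j where p: "p = (i, j)" "i < m" "j < n" by auto
    show "for_generic m n (\<lambda>U. U $$ p \<noteq> 0)"
      unfolding for_generic_iff p(1)
      by (rule bexI[OF _ poly_funs.entry[OF p(2,3)]]) (use p in \<open>auto intro!: bexI[of _ ?J]\<close>)
  qed simp
  thus "for_generic m n (\<lambda>U. \<forall>i<m. \<forall>j<n. U $$ (i, j) \<noteq> 0)" by (rule for_generic_mono) auto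
  have "(\<lambda>U. \<Sum>i<m. \<Sum>j<n. U $$ (i, j)) \<in> poly_funs m n"
    by (intro poly_funs_sum) (auto intro: poly_funs.entry)
  moreover have "(\<Sum>i<m. \<Sum>j<n. ?J $$ (i, j)) = of_nat (m * n)" by simp
  ultimately show "for_generic m n (\<lambda>U. sum_mat U \<noteq> 0)"
    unfolding for_generic_iff using assms
    by (intro bexI[of _ "\<lambda>U. \<Sum>i<m. \<Sum>j<n. U $$ (i, j)"] conjI)
       (auto simp: sum_mat_eq[of _ m n] intro!: bexI[of _ ?J])
qed

lemma two_sided_normal_permute:
  assumes P: "P \<in> carrier_mat m n" and D: "D \<in> carrier_mat m n"
    and \<sigma>: "\<sigma> permutes {..<m}" and \<tau>: "\<tau> permutes {..<n}" and normal: "two_sided_normal m n P D"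
  shows "two_sided_normal m n (permute_mat \<sigma> \<tau> P) (permute_mat \<sigma> \<tau> D)"
  unfolding two_sided_normal_def
proof (intro conjI allI impI)
  have \<sigma>m: "\<sigma> i < m" if "i < m" for i using permutes_in_image[OF \<sigma>, of i] that by simp
  have \<tau>n: "\<tau> i < n" if "i < n" for i using permutes_in_image[OF \<tau>, of i] that by simp
  {
    fix i k assume ik: "i < m" "k < m"
    have "(\<Sum>b<n. permute_mat \<sigma> \<tau> D $$ (i, b) * permute_mat \<sigma> \<tau> P $$ (k, b)) =
        (\<Sum>b<n. D $$ (\<sigma> i, \<tau> b) * P $$ (\<sigma> k, \<tau> b))"
      using ik P D by (intro sum.cong) (auto simp: permute_mat_def)
    also have "\<dots> = (\<Sum>b<n. D $$ (\<sigma> i, b) * P $$ (\<sigma> k, b))"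
      using sum.permute[OF \<tau>, of "\<lambda>b. D $$ (\<sigma> i, b) * P $$ (\<sigma> k, b)"] by (simp add: comp_def)
    finally show "(\<Sum>b<n. permute_mat \<sigma> \<tau> D $$ (i, b) * permute_mat \<sigma> \<tau> P $$ (k, b)) = 0"
      using normal \<sigma>m ik unfolding two_sided_normal_def by simp
  next
    fix j l assume jl: "j < n" "l < n"
    have "(\<Sum>a<m. permute_mat \<sigma> \<tau> D $$ (a, j) * permute_mat \<sigma> \<tau> P $$ (a, l)) =
        (\<Sum>a<m. D $$ (\<sigma> a, \<tau> j) * P $$ (\<sigma> a, \<tau> l))"
      using jl P D by (intro sum.cong) (auto simp: permute_mat_def)
    also have "\<dots> = (\<Sum>a<m. D $$ (a, \<tau> j) * P $$ (a, \<tau> l))"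
      using sum.permute[OF \<sigma>, of "\<lambda>a. D $$ (a, \<tau> j) * P $$ (a, \<tau> l)"] by (simp add: comp_def)
    finally show "(\<Sum>a<m. permute_mat \<sigma> \<tau> D $$ (a, j) * permute_mat \<sigma> \<tau> P $$ (a, l)) = 0"
      using normal \<tau>n jl unfolding two_sided_normal_def by simp
  }
qed

lemma card_unknown_positions:
  assumes "r \<le> m" "r \<le> n"
  shows "card (unknown_positions m n r) = m * n"
proof -
  obtain a b where ab: "m = r + a" "n = r + b" using assms le_Suc_ex by blast
  show ?thesis
    by (simp add: unknown_positions_def card_Plus card_cartesian_product ab algebra_simps)
qed

section \<open>Solutions and critical points\<close>

text \<open>Pairing the system with the all-ones matrix gives \<open>s = s p\<close>, where \<open>p\<close> is the entry sum
  of \<open>P\<close>, because \<open>P\<close> and \<open>(R \<Lambda> L)\<^sup>T\<close> are orthogonal; so \<open>p = 1\<close>. No entry of \<open>P\<close>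
  vanishes since every entry of \<open>U\<close> is a multiple of the one of \<open>P\<close>. Dividing by it, the
  gradient matrix is \<open>(R \<Lambda> L)\<^sup>T\<close>, which is normal.\<close>

lemma solution_is_critical_point:
  assumes P1: "P1 \<in> carrier_mat r r" and L1: "L1 \<in> carrier_mat (m - r) r" and R1: "R1 \<in> carrier_mat r (n - r)"
    and \<Lambda>: "\<Lambda> \<in> carrier_mat (n - r) (m - r)" and r: "r \<le> m" "r \<le> n" and det: "det P1 \<noteq> 0"
    and U: "U \<in> carrier_mat m n" "\<forall>i<m. \<forall>j<n. U $$ (i, j) \<noteq> 0" "sum_mat U \<noteq> 0"
    and sol: "system_lhs U (P1, L1, R1, \<Lambda>) = U"
  shows "block_P P1 L1 R1 \<in> critical_points m n r U"
proof -
  define P where "P = block_P P1 L1 R1"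
  define G where "G = normal_mat L1 R1 \<Lambda>"
  have P: "P \<in> carrier_mat m n" unfolding P_def by (rule block_P_carrier[OF P1 L1 R1 r])
  have G: "G \<in> carrier_mat m n" unfolding G_def by (rule normal_mat_carrier[OF L1 R1 \<Lambda> r])
  note Rc = block_R_carrier[OF R1 r(2)]
  have eq: "U $$ (i, j) = P $$ (i, j) * G $$ (i, j) + sum_mat U * P $$ (i, j)" if "i < m" "j < n" for i j
    using system_lhs_entry[OF P1 L1 R1 \<Lambda> r that, of U] sol by (simp add: P_def G_def)
  have nz: "P $$ (i, j) \<noteq> 0" if "i < m" "j < n" for i j using eq[OF that] U(2) that by auto
  have "mat_form m n G P = 0" unfolding G_def
  proof (rule normal_mat_form[OF L1 R1 \<Lambda> r P])
    show "block_L L1 * P * block_R R1 = 0\<^sub>m (m - r) (n - r)"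
      unfolding P_def block_L_mult_block_P[OF P1 L1 R1 r] by (rule left_mult_zero_mat[OF Rc])
  qed
  hence GP: "(\<Sum>i<m. \<Sum>j<n. P $$ (i, j) * G $$ (i, j)) = 0" by (simp add: mat_form_def mult.commute)
  have "sum_mat U = (\<Sum>i<m. \<Sum>j<n. P $$ (i, j) * G $$ (i, j) + sum_mat U * P $$ (i, j))"
    unfolding sum_mat_eq[OF U(1)]
    by (intro sum.cong refl) (simp only: lessThan_iff eq sum_mat_eq[OF U(1), symmetric])
  also have "\<dots> = sum_mat U * sum_mat P"
    unfolding sum_mat_eq[OF P] by (simp only: sum.distrib GP sum_distrib_left add_0)
  finally have "sum_mat U = sum_mat U * sum_mat P" .
  hence sumP: "sum_mat P = 1" using U(3) by simp
  have D: "mat m n (\<lambda>(i, j). U $$ (i, j) / P $$ (i, j) - sum_mat U) = G"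
    using G by (intro eq_matI) (auto simp: eq nz field_simps)
  have "G \<in> mat_perp m n (tangent_space m n (determinantal_variety m n r) P)"
    unfolding mat_perp_def
  proof (intro CollectI conjI ballI G)
    fix X assume X: "X \<in> tangent_space m n (determinantal_variety m n r) P"
    hence Xc: "X \<in> carrier_mat m n" by (simp add: tangent_space_def)
    show "mat_form m n G X = 0" unfolding G_def
      by (rule normal_mat_form[OF L1 R1 \<Lambda> r Xc tangent_space_annihilated[OF P1 L1 R1 r det]])
         (use X in \<open>simp add: P_def\<close>)
  qed
  thus ?thesis
    using P sumP nz D block_P_rank[OF P1 L1 R1 r det] unfolding critical_points_def P_def by simp
qed

lemma rescaled_system_pack_eq_system_lhs:
  assumes c: "P1 \<in> carrier_mat r r" "L1 \<in> carrier_mat (m - r) r" "R1 \<in> carrier_mat r (n - r)"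
    "\<Lambda> \<in> carrier_mat (n - r) (m - r)" and r: "r \<le> m" "r \<le> n" and U: "sum_mat U \<noteq> 0"
  shows "rescaled_system m n r (pack (sum_mat U \<cdot>\<^sub>m P1) L1 R1 ((1 / sum_mat U) \<cdot>\<^sub>m \<Lambda>)) =
    system_lhs U (P1, L1, R1, \<Lambda>)"
proof -
  have "system_lhs U (P1, L1, R1, \<Lambda>) \<in> carrier_mat m n"
    by (rule system_lhs_carrier[OF _ r]) (use c in \<open>simp add: unknowns_def\<close>)
  thus ?thesis
    unfolding rescaled_system_pack[OF c r U]
    by (intro eq_matI) (auto simp: system_lhs_entry[OF c r])
qed

text \<open>The rescaling is invertible once \<open>U\<close>, hence the scaling factor, is fixed.\<close>

lemma finite_solutions_if_finite_fibre:
  assumes r: "r \<le> m" "r \<le> n" and U: "sum_mat U \<noteq> 0"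
    and fibre: "finite {X \<in> carrier_mat m n. rescaled_system m n r X = U}"
  shows "finite (solutions m n r U)"
proof -
  define s where "s = sum_mat U"
  define restore where "restore X =
    ((1 / s) \<cdot>\<^sub>m unpack_P r X, unpack_L m r X, unpack_R n r X, s \<cdot>\<^sub>m unpack_\<Lambda> m n r X)" for X
  have "solutions m n r U \<subseteq> restore ` {X \<in> carrier_mat m n. rescaled_system m n r X = U}"
  proof
    fix x assume x: "x \<in> solutions m n r U"
    obtain P1 L1 R1 \<Lambda> where x4: "x = (P1, L1, R1, \<Lambda>)" by (cases x)
    have c: "P1 \<in> carrier_mat r r" "L1 \<in> carrier_mat (m - r) r" "R1 \<in> carrier_mat r (n - r)"
      "\<Lambda> \<in> carrier_mat (n - r) (m - r)" and sol: "system_lhs U (P1, L1, R1, \<Lambda>) = U"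
      using x unfolding solutions_def unknowns_def x4 by auto
    define X where "X = pack (s \<cdot>\<^sub>m P1) L1 R1 ((1 / s) \<cdot>\<^sub>m \<Lambda>)"
    have c': "s \<cdot>\<^sub>m P1 \<in> carrier_mat r r" "(1 / s) \<cdot>\<^sub>m \<Lambda> \<in> carrier_mat (n - r) (m - r)" using c by auto
    have "X \<in> carrier_mat m n" unfolding X_def by (rule pack_carrier[OF c' r])
    moreover have "rescaled_system m n r X = U"
      unfolding X_def s_def rescaled_system_pack_eq_system_lhs[OF c r U] by (rule sol)
    moreover have "(1 / s) \<cdot>\<^sub>m (s \<cdot>\<^sub>m P1) = P1" "s \<cdot>\<^sub>m ((1 / s) \<cdot>\<^sub>m \<Lambda>) = \<Lambda>"
      using U by (auto simp: s_def intro!: eq_matI)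
    hence "x = restore X"
      unfolding restore_def x4 X_def unpack_pack[OF c'(1) c(2,3) c'(2) r] by simp
    ultimately show "x \<in> restore ` {X \<in> carrier_mat m n. rescaled_system m n r X = U}" by blast
  qed
  thus ?thesis using fibre by (meson finite_imageI finite_subset)
qed

lemma solution_leading_block_invertible:
  assumes generic: "avoids_degenerate_charts m n r U"
    and c: "P1 \<in> carrier_mat r r" "L1 \<in> carrier_mat (m - r) r" "R1 \<in> carrier_mat r (n - r)"
      "\<Lambda> \<in> carrier_mat (n - r) (m - r)" and r: "r \<le> m" "r \<le> n"
    and U: "U \<in> carrier_mat m n" "sum_mat U \<noteq> 0" and sol: "system_lhs U (P1, L1, R1, \<Lambda>) = U"
  shows "det P1 \<noteq> 0"
proof -
  define s where "s = sum_mat U"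
  define X where "X = pack (s \<cdot>\<^sub>m P1) L1 R1 ((1 / s) \<cdot>\<^sub>m \<Lambda>)"
  have c': "s \<cdot>\<^sub>m P1 \<in> carrier_mat r r" "(1 / s) \<cdot>\<^sub>m \<Lambda> \<in> carrier_mat (n - r) (m - r)" using c by auto
  have X: "X \<in> carrier_mat m n" unfolding X_def by (rule pack_carrier[OF c' r])
  have "permute_mat id id (rescaled_system m n r X) = U"
    unfolding X_def s_def rescaled_system_pack_eq_system_lhs[OF c r U(2)] sol
    using U(1) by (intro eq_matI) (auto simp: permute_mat_def)
  hence "minor (unpack_block m n r X) r id id \<noteq> 0"
    using generic X permutes_id unfolding avoids_degenerate_charts_def by blast
  hence "minor (block_P (s \<cdot>\<^sub>m P1) L1 R1) r id id \<noteq> 0"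
    unfolding unpack_block_def X_def unpack_pack[OF c'(1) c(2,3) c'(2) r] .
  moreover have "mat r r (\<lambda>(i, j). block_P (s \<cdot>\<^sub>m P1) L1 R1 $$ (i, j)) = s \<cdot>\<^sub>m P1"
    using c' r c(1) by (intro eq_matI) (auto simp: block_P_entry[OF c'(1) c(2,3) r])
  ultimately show ?thesis by (auto simp: minor_def)
qed

text \<open>Permuting a nonzero \<open>r\<close>-minor of \<open>P\<close> into the leading position yields a point of the
  chart, with normal vector \<open>(R \<Lambda> L)\<^sup>T\<close>, and hence a preimage \<open>X\<close> of the permuted data. The
  genericity condition for the inverse permutations then speaks about the leading minor of
  \<open>P\<close> itself.\<close>

lemma normal_direction_leading_minor:
  assumes generic: "avoids_degenerate_charts m n r U"
    and P: "P \<in> carrier_mat m n" and rank: "vec_space.rank m P = r" and D: "D \<in> carrier_mat m n"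
    and normal: "two_sided_normal m n P D" and r: "r \<le> m" "r \<le> n" and U: "U \<in> carrier_mat m n" and s0: "s \<noteq> 0"
    and U_eq: "\<And>i j. i < m \<Longrightarrow> j < n \<Longrightarrow> U $$ (i, j) = P $$ (i, j) * D $$ (i, j) + s * P $$ (i, j)"
  shows "minor P r id id \<noteq> 0"
proof -
  obtain \<sigma> \<tau> where \<sigma>: "\<sigma> permutes {..<m}" and \<tau>: "\<tau> permutes {..<n}" and minor: "minor P r \<sigma> \<tau> \<noteq> 0"
    using rank_minor_exists[OF P] unfolding rank by blast
  have \<sigma>m: "\<sigma> i < m" if "i < m" for i using permutes_in_image[OF \<sigma>, of i] that by simp
  have \<tau>n: "\<tau> i < n" if "i < n" for i using permutes_in_image[OF \<tau>, of i] that by simp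
  let ?\<sigma> = "inv_into UNIV \<sigma>" and ?\<tau> = "inv_into UNIV \<tau>"
  have \<sigma>': "?\<sigma> permutes {..<m}" and \<tau>': "?\<tau> permutes {..<n}"
    by (rule permutes_inv[OF \<sigma>], rule permutes_inv[OF \<tau>])
  define P' where "P' = permute_mat \<sigma> \<tau> P"
  define D' where "D' = permute_mat \<sigma> \<tau> D"
  have P'D': "P' \<in> carrier_mat m n" "D' \<in> carrier_mat m n"
    using permute_mat_carrier[OF P] permute_mat_carrier[OF D] by (simp_all add: P'_def D'_def)
  have P_back: "permute_mat ?\<sigma> ?\<tau> P' = P" unfolding P'_def by (rule permute_mat_inverse[OF P \<sigma> \<tau>])
  obtain B C where BC: "B \<in> carrier_mat m r" "C \<in> carrier_mat r n" "P = B * C"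
    using vec_space.rank_factorization[OF P] unfolding rank by blast
  have "vec_space.rank m P' \<le> r"
    unfolding P'_def BC(3) permute_mat_mult[OF BC(1,2) \<sigma> \<tau>]
    by (rule vec_space.rank_mult_le_inner_dim[OF permute_mat_carrier[OF BC(1)] permute_mat_carrier[OF BC(2)]])
  moreover have "minor P' r id id \<noteq> 0"
    unfolding P'_def using minor_permute_mat[OF P, of r id id \<sigma> \<tau>] minor r by simp
  ultimately obtain P1 L1 R1 where c: "P1 \<in> carrier_mat r r" "L1 \<in> carrier_mat (m - r) r"
    "R1 \<in> carrier_mat r (n - r)" and P'_block: "P' = block_P P1 L1 R1" and det: "det P1 \<noteq> 0"
    using block_P_if_rank_le[OF P'D'(1) r] by blast
  have "two_sided_normal m n (block_P P1 L1 R1) D'"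
    using two_sided_normal_permute[OF P D \<sigma> \<tau> normal] unfolding P'_block[symmetric] P'_def D'_def .
  then obtain \<Lambda> where \<Lambda>: "\<Lambda> \<in> carrier_mat (n - r) (m - r)" and D'_normal: "D' = normal_mat L1 R1 \<Lambda>"
    using two_sided_normal_block[OF c r det P'D'(2)] by blast
  define X where "X = pack (s \<cdot>\<^sub>m P1) L1 R1 ((1 / s) \<cdot>\<^sub>m \<Lambda>)"
  have c': "s \<cdot>\<^sub>m P1 \<in> carrier_mat r r" "(1 / s) \<cdot>\<^sub>m \<Lambda> \<in> carrier_mat (n - r) (m - r)" using c \<Lambda> by auto
  have X: "X \<in> carrier_mat m n" unfolding X_def by (rule pack_carrier[OF c' r])
  have "rescaled_system m n r X = permute_mat \<sigma> \<tau> U"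
    unfolding X_def rescaled_system_pack[OF c \<Lambda> r s0] P'_block[symmetric] D'_normal[symmetric]
    using U P D \<sigma>m \<tau>n by (intro eq_matI) (auto simp: P'_def D'_def permute_mat_def U_eq)
  hence "permute_mat ?\<sigma> ?\<tau> (rescaled_system m n r X) = U" using permute_mat_inverse[OF U \<sigma> \<tau>] by simp
  hence "minor (unpack_block m n r X) r ?\<sigma> ?\<tau> \<noteq> 0"
    using generic \<sigma>' \<tau>' X unfolding avoids_degenerate_charts_def by blast
  hence "minor (s \<cdot>\<^sub>m P') r ?\<sigma> ?\<tau> \<noteq> 0"
    unfolding unpack_block_def X_def unpack_pack[OF c'(1) c(2,3) c'(2) r]
      block_P_smult[OF c r] P'_block[symmetric] .
  moreover have "minor (s \<cdot>\<^sub>m P') r ?\<sigma> ?\<tau> = s ^ r * minor P r id id"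
  proof -
    have "?\<sigma> i < m" "?\<tau> i < n" if "i < r" for i
      using permutes_in_image[OF \<sigma>', of i] permutes_in_image[OF \<tau>', of i] that r by auto
    moreover have "P $$ (i, j) = P' $$ (?\<sigma> i, ?\<tau> j)" if "i < r" "j < r" for i j
      using that r P'D'(1) by (subst P_back[symmetric]) (simp add: permute_mat_def)
    ultimately have "mat r r (\<lambda>(i, j). (s \<cdot>\<^sub>m P') $$ (?\<sigma> i, ?\<tau> j)) = s \<cdot>\<^sub>m mat r r (\<lambda>(i, j). P $$ (id i, id j))"
      using P'D'(1) by (intro eq_matI) auto
    thus ?thesis by (simp add: minor_def)
  qed
  ultimately show ?thesis by auto
qed

lemma critical_point_is_solution:
  assumes generic: "avoids_degenerate_charts m n r U" and r: "r \<le> m" "r \<le> n"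
    and U: "U \<in> carrier_mat m n" "sum_mat U \<noteq> 0" and crit: "P \<in> critical_points m n r U"
  shows "P \<in> (\<lambda>(P1, L1, R1, \<Lambda>). block_P P1 L1 R1) ` solutions m n r U"
proof -
  define s where "s = sum_mat U"
  define D where "D = mat m n (\<lambda>(i, j). U $$ (i, j) / P $$ (i, j) - s)"
  have P: "P \<in> carrier_mat m n" and rank: "vec_space.rank m P = r"
    and Pnz: "\<And>i j. i < m \<Longrightarrow> j < n \<Longrightarrow> P $$ (i, j) \<noteq> 0"
    and perp: "D \<in> mat_perp m n (tangent_space m n (determinantal_variety m n r) P)"
    using crit by (auto simp: critical_points_def D_def s_def)
  have D: "D \<in> carrier_mat m n" by (simp add: D_def)
  have normal: "two_sided_normal m n P D"
    by (rule mat_perp_two_sided_normal[OF P _ perp]) (simp add: rank)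
  have U_eq: "U $$ (i, j) = P $$ (i, j) * D $$ (i, j) + s * P $$ (i, j)" if "i < m" "j < n" for i j
    using Pnz[OF that] that by (simp add: D_def field_simps)
  have "minor P r id id \<noteq> 0"
    by (rule normal_direction_leading_minor[OF generic P rank D normal r U(1) _ U_eq])
       (use U(2) in \<open>simp_all add: s_def\<close>)
  then obtain P1 L1 R1 where c: "P1 \<in> carrier_mat r r" "L1 \<in> carrier_mat (m - r) r"
    "R1 \<in> carrier_mat r (n - r)" and block: "P = block_P P1 L1 R1" and det: "det P1 \<noteq> 0"
    using block_P_if_rank_le[OF P r] rank by blast
  obtain \<Lambda> where \<Lambda>: "\<Lambda> \<in> carrier_mat (n - r) (m - r)" and D_normal: "D = normal_mat L1 R1 \<Lambda>"
    using two_sided_normal_block[OF c r det D] normal unfolding block by blast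
  have in_unknowns: "(P1, L1, R1, \<Lambda>) \<in> unknowns m n r" using c \<Lambda> by (simp add: unknowns_def)
  have "system_lhs U (P1, L1, R1, \<Lambda>) = U"
    using U(1) system_lhs_carrier[OF in_unknowns r, of U]
    by (intro eq_matI) (auto simp: system_lhs_entry[OF c \<Lambda> r] U_eq s_def block[symmetric] D_normal[symmetric])
  hence "(P1, L1, R1, \<Lambda>) \<in> solutions m n r U" using in_unknowns by (simp add: solutions_def)
  thus ?thesis by (rule rev_image_eqI) (simp add: block)
qed

theorem theorem2p1:
  fixes r m n :: nat
  assumes "1 \<le> r" and "r \<le> m" and "m \<le> n"
  shows "card (unknown_positions m n r) = m * n
    \<and> (\<forall>U \<in> carrier_mat m n. \<forall>x \<in> unknowns m n r. system_lhs U x \<in> carrier_mat m n)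
    \<and> for_generic m n (\<lambda>U.
        finite (solutions m n r U)
        \<and> (\<lambda>(P1, L1, R1, \<Lambda>). block_P P1 L1 R1) ` solutions m n r U = critical_points m n r U)"
proof (intro conjI ballI)
  have r: "r \<le> m" "r \<le> n" using assms by auto
  show "card (unknown_positions m n r) = m * n" by (rule card_unknown_positions[OF r])
  show "system_lhs U x \<in> carrier_mat m n" if "x \<in> unknowns m n r" for U x
    by (rule system_lhs_carrier[OF that r])
  have nz: "for_generic m n (\<lambda>U. (\<forall>i<m. \<forall>j<n. U $$ (i, j) \<noteq> 0) \<and> sum_mat U \<noteq> 0)"
    using assms by (intro generic_nonzero_entries) auto
  note generic = for_generic_conj[OF generic_avoids_degenerate_charts[OF r]
    for_generic_conj[OF generic_finite_fibre[OF poly_map_rescaled_system[OF r]] nz]]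
  show "for_generic m n (\<lambda>U. finite (solutions m n r U)
        \<and> (\<lambda>(P1, L1, R1, \<Lambda>). block_P P1 L1 R1) ` solutions m n r U = critical_points m n r U)"
  proof (rule for_generic_mono[OF generic])
    fix U :: "complex mat" assume U: "U \<in> carrier_mat m n"
    assume "avoids_degenerate_charts m n r U \<and> finite {X \<in> carrier_mat m n. rescaled_system m n r X = U} \<and>
      (\<forall>i<m. \<forall>j<n. U $$ (i, j) \<noteq> 0) \<and> sum_mat U \<noteq> 0"
    hence charts: "avoids_degenerate_charts m n r U"
      and fibre: "finite {X \<in> carrier_mat m n. rescaled_system m n r X = U}"
      and nz: "\<forall>i<m. \<forall>j<n. U $$ (i, j) \<noteq> 0" and s0: "sum_mat U \<noteq> 0" by auto
    have "block_P P1 L1 R1 \<in> critical_points m n r U" if "(P1, L1, R1, \<Lambda>) \<in> solutions m n r U" for P1 L1 R1 \<Lambda>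
    proof -
      have c: "P1 \<in> carrier_mat r r" "L1 \<in> carrier_mat (m - r) r" "R1 \<in> carrier_mat r (n - r)"
        "\<Lambda> \<in> carrier_mat (n - r) (m - r)" and sol: "system_lhs U (P1, L1, R1, \<Lambda>) = U"
        using that unfolding solutions_def unknowns_def by auto
      show ?thesis
        by (rule solution_is_critical_point[OF c r solution_leading_block_invertible[OF charts c r U s0 sol] U nz s0 sol])
    qed
    hence "(\<lambda>(P1, L1, R1, \<Lambda>). block_P P1 L1 R1) ` solutions m n r U = critical_points m n r U"
      using critical_point_is_solution[OF charts r U s0] by auto
    thus "finite (solutions m n r U)
        \<and> (\<lambda>(P1, L1, R1, \<Lambda>). block_P P1 L1 R1) ` solutions m n r U = critical_points m n r U"
      using finite_solutions_if_finite_fibre[OF r s0 fibre] by blast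
  qed
qed

end
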